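(* Let $A$ be a quasitriangular quasi-Hopf algebra over a field $K$ with antipode $S$ and Drinfel'd element $u$, and let $\hat u,\check u\in A$ be the (invertible) elements defined by $$\hat u := \sum_i S(Z_i)\,\hat\alpha\, Y_i\, S^{-1}(\beta)\, S^{-1}(X_i),\qquad \check u := \sum_i S(Z_i)\,\check\alpha\, Y_i\, S^{-1}(\beta)\, S^{-1}(X_i),$$ where $\hat\alpha := \sum_l S(\bar s_l)\alpha\bar t_l$ and $\check\alpha := \sum_l S(t_l)\alpha s_l$, with $R=\sum_l s_l\otimes t_l$ the R-matrix and $R^{-1}=\sum_l\bar s_l\otimes\bar t_l$. Then $$u = \check u = S(\hat u^{-1}).$$
   Context: All tensor products are over a fixed field $K$. A quasi-bialgebra $(A,\Delta,\varepsilon,\Phi)$ is an associative unital $K$-algebra $A$ with algebra homomorphisms $\Delta: A \to A\otimes A$ and $\varepsilon: A \to K$ and an invertible element $\Phi \in A\otimes A\otimes A$ such that, for all $a \in A$: (1) $(\mathrm{id}\otimes\Delta)\Delta(a)\,\Phi = \Phi\,(\Delta\otimes\mathrm{id})\Delta(a)$; (2) $(\mathrm{id}\otimes\mathrm{id}\otimes\Delta)(\Phi)(\Delta\otimes\mathrm{id}\otimes\mathrm{id})(\Phi) = (1\otimes\Phi)(\mathrm{id}\otimes\Delta\otimes\mathrm{id})(\Phi)(\Phi\otimes 1)$; (3) $(\varepsilon\otimes\mathrm{id})\Delta(a) = a = (\mathrm{id}\otimes\varepsilon)\Delta(a)$; (4) $(\mathrm{id}\otimes\varepsilon\otimes\mathrm{id})(\Phi)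 = 1\otimes 1$. Notation: $\Delta(a) = a_{(1)}\otimes a_{(2)}$, $\Delta^{\mathrm{cop}}(a) = a_{(2)}\otimes a_{(1)}$, $\Phi = \sum_i X_i\otimes Y_i\otimes Z_i$, $\Phi^{-1} = \sum_j \bar X_j\otimes\bar Y_j\otimes\bar Z_j$. A quasi-Hopf algebra is a quasi-bialgebra with an algebra anti-automorphism $S: A\to A$ (the antipode, in particular bijective) and elements $\alpha,\beta\in A$ such that, for all $a\in A$, $S(a_{(1)})\alpha a_{(2)} = \varepsilon(a)\alpha$, $a_{(1)}\beta S(a_{(2)}) = \varepsilon(a)\beta$, and $\sum_i X_i\beta S(Y_i)\alpha Z_i = 1 = \sum_j S(\bar X_j)\alpha\bar Y_j\beta S(\bar Z_j)$. A quasi-Hopf algebra is quasitriangular if it is endowed with an R-matrix, i.e. an invertible element $R = \sum_l s_l\otimes t_l\in A\otimes A$ such that (1) $\Delta^{\mathrm{cop}}(a)R = R\Delta(a)$ for all $a\in A$; (2) $(\Delta\otimes\mathrm{id})(R) = \sum_{i,j,k,l,q} Y_i s_l\bar X_j X_k\otimes Z_i\bar Z_j s_q Y_k\otimes X_i t_l\bar Y_j t_q Z_k$; (3) $(\mathrm{id}\otimes\Delta)(R) = \sum_{i,j,k,l,q}\bar Z_i s_l Y_j s_q\bar X_k\otimes\bar X_i X_j t_q\bar Y_k\otimes\bar Y_i t_l Z_j\bar Z_k$. The Drinfel'd element is $u := \sum_{i,l} S(\bar Y_i\beta S(\bar Z_i))\,S(t_l)\,\alpha\, s_l\,\bar X_i$.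 It is known (from the essential uniqueness of antipodes of quasi-Hopf algebras, applied to the coopposite quasi-Hopf algebra, viewed as the twist of $A$ by $R$, respectively by $R'^{-1}$ where $R'=\sum_l t_l\otimes s_l$) that $\hat u$ and $\check u$ are invertible, with inverses $\hat u^{-1} = \sum_i S^{-1}(Z_i)S^{-1}(\alpha)Y_i\hat\beta S(X_i)$ and $\check u^{-1} = \sum_i S^{-1}(Z_i)S^{-1}(\alpha)Y_i\check\beta S(X_i)$, where $\hat\beta := \sum_l s_l\beta S(t_l)$ and $\check\beta := \sum_l\bar t_l\beta S(\bar s_l)$. *)

theory Defs
  imports Complex_Main "HOL-Library.Poly_Mapping"
begin

section \<open>Formal linear combinations\<close>

definition fscale :: "'k::field \<Rightarrow> ('x \<Rightarrow>\<^sub>0 'k) \<Rightarrow> ('x \<Rightarrow>\<^sub>0 'k)"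
  where "fscale c p = Poly_Mapping.map ((*) c) p"

lemma lookup_fscale: "Poly_Mapping.lookup (fscale c p) x = c * Poly_Mapping.lookup p x"
  unfolding fscale_def by (simp add: map.rep_eq when_def)

interpretation free: vector_space fscale
  by unfold_locales
    (auto intro!: poly_mapping_eqI simp: lookup_fscale lookup_add algebra_simps)

definition fbilinear ::
    "('x \<Rightarrow> 'y \<Rightarrow> 'z) \<Rightarrow> ('x \<Rightarrow>\<^sub>0 'k::field) \<Rightarrow> ('y \<Rightarrow>\<^sub>0 'k) \<Rightarrow> ('z \<Rightarrow>\<^sub>0 'k)"
  where "fbilinear h p q =
    (\<Sum>x\<in>Poly_Mapping.keys p. \<Sum>y\<in>Poly_Mapping.keys q. Poly_Mapping.single (h x y) (Poly_Mapping.lookup p x * Poly_Mapping.lookup q y))"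


section \<open>Algebras over a field and their tensor powers\<close>

locale k_algebra = vector_space scale
  for scale :: "'k::field \<Rightarrow> 'a::ring_1 \<Rightarrow> 'a" (infixr "*s" 75) +
  assumes scale_mult_left: "(c *s x) * y = c *s (x * y)"
    and scale_mult_right: "x * (c *s y) = c *s (x * y)"

text \<open>
  The \<open>n\<close>-fold tensor power of \<open>A\<close> over \<open>K\<close> is the free vector space on the \<open>n\<close>-tuples (lists of
  length \<open>n\<close>) of elements of \<open>A\<close>, modulo the subspace spanned by the multilinearity relations.
  As the relations depend on \<open>scale\<close>, a tensor is a coset, that is, a set of formal linear
  combinations, and the tensor power is a set of cosets. Every operation on tensors is given on
  representatives; its value does not depend on their choice. The numeric arguments of the
  operations are the numbers of tensor factors.
\<close>

type_synonym ('k, 'a) tensor = "('a list \<Rightarrow>\<^sub>0 'k) set"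

context k_algebra
begin

definition formal :: "nat \<Rightarrow> ('a list \<Rightarrow>\<^sub>0 'k) set"
  where "formal n = {p. \<forall>xs\<in>Poly_Mapping.keys p. length xs = n}"

definition multilinear_relations :: "nat \<Rightarrow> ('a list \<Rightarrow>\<^sub>0 'k) set"
  where "multilinear_relations n =
    {Poly_Mapping.single (xs @ (a + b) # ys) 1
       - Poly_Mapping.single (xs @ a # ys) 1 - Poly_Mapping.single (xs @ b # ys) 1
     | xs a b ys. length xs + 1 + length ys = n}
    \<union> {Poly_Mapping.single (xs @ (c *s a) # ys) 1
       - fscale c (Poly_Mapping.single (xs @ a # ys) 1)
     | xs c a ys. length xs + 1 + length ys = n}"

definition tensor_rel :: "nat \<Rightarrow> (('a list \<Rightarrow>\<^sub>0 'k) \<times> ('a list \<Rightarrow>\<^sub>0 'k)) set"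
  where "tensor_rel n =
    {(p, q). p \<in> formal n \<and> q \<in> formal n \<and> p - q \<in> free.span (multilinear_relations n)}"

definition tensor_power :: "nat \<Rightarrow> ('k, 'a) tensor set"
  where "tensor_power n = formal n // tensor_rel n"

definition tclass :: "nat \<Rightarrow> ('a list \<Rightarrow>\<^sub>0 'k) \<Rightarrow> ('k, 'a) tensor"
  where "tclass n p = tensor_rel n `` {p}"

definition pure :: "'a list \<Rightarrow> ('k, 'a) tensor"
  where "pure xs = tclass (length xs) (Poly_Mapping.single xs 1)"

definition tadd :: "nat \<Rightarrow> ('k, 'a) tensor \<Rightarrow> ('k, 'a) tensor \<Rightarrow> ('k, 'a) tensor"
  where "tadd n s t = (\<Union>p\<in>s. \<Union>q\<in>t. tclass n (p + q))"

definition tscale :: "nat \<Rightarrow> 'k \<Rightarrow> ('k, 'a) tensor \<Rightarrow> ('k, 'a) tensor"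
  where "tscale n c t = (\<Union>p\<in>t. tclass n (fscale c p))"

definition tone :: "nat \<Rightarrow> ('k, 'a) tensor"
  where "tone n = pure (replicate n 1)"

definition tmult :: "nat \<Rightarrow> ('k, 'a) tensor \<Rightarrow> ('k, 'a) tensor \<Rightarrow> ('k, 'a) tensor"
  where "tmult n s t = (\<Union>p\<in>s. \<Union>q\<in>t. tclass n (fbilinear (map2 (*)) p q))"

text \<open>The outer product, from the \<open>m\<close>-fold and the \<open>n\<close>-fold to the \<open>(m + n)\<close>-fold tensor power.\<close>

definition touter :: "nat \<Rightarrow> nat \<Rightarrow> ('k, 'a) tensor \<Rightarrow> ('k, 'a) tensor \<Rightarrow> ('k, 'a) tensor"
  where "touter m n s t = (\<Union>p\<in>s. \<Union>q\<in>t. tclass (m + n) (fbilinear (@) p q))"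

definition tinvertible :: "nat \<Rightarrow> ('k, 'a) tensor \<Rightarrow> bool"
  where "tinvertible n s \<longleftrightarrow> s \<in> tensor_power n \<and>
    (\<exists>t\<in>tensor_power n. tmult n s t = tone n \<and> tmult n t s = tone n)"

definition tinverse :: "nat \<Rightarrow> ('k, 'a) tensor \<Rightarrow> ('k, 'a) tensor"
  where "tinverse n s =
    (THE t. t \<in> tensor_power n \<and> tmult n s t = tone n \<and> tmult n t s = tone n)"

text \<open>
  For a multilinear \<open>f\<close>, the linear map on the \<open>n\<close>-fold tensor power induced by \<open>f\<close>: the sum of
  \<open>f x\<^sub>1 \<dots> x\<^sub>n\<close> over the pure tensors in a presentation of the argument. In \<open>sum_alg\<close> the values
  lie in \<open>A\<close>, in \<open>sum_ten m\<close> they lie in the \<open>m\<close>-fold tensor power. By multilinearity, the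
  representatives in the argument and in the values of \<open>f\<close> do not matter.
\<close>

definition sum_alg :: "('k, 'a) tensor \<Rightarrow> ('a list \<Rightarrow> 'a) \<Rightarrow> 'a"
  where "sum_alg t f = the_elem ((\<lambda>p. \<Sum>xs\<in>Poly_Mapping.keys p. Poly_Mapping.lookup p xs *s f xs) ` t)"

definition sum_ten :: "nat \<Rightarrow> ('k, 'a) tensor \<Rightarrow> ('a list \<Rightarrow> ('k, 'a) tensor) \<Rightarrow> ('k, 'a) tensor"
  where "sum_ten m t f =
    (\<Union>p\<in>t. tclass m (\<Sum>xs\<in>Poly_Mapping.keys p. fscale (Poly_Mapping.lookup p xs) (SOME q. q \<in> f xs)))"

abbreviation sum_alg2 :: "('k, 'a) tensor \<Rightarrow> ('a \<Rightarrow> 'a \<Rightarrow> 'a) \<Rightarrow> 'a"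
  where "sum_alg2 t f \<equiv> sum_alg t (\<lambda>xs. f (xs ! 0) (xs ! 1))"

abbreviation sum_alg3 :: "('k, 'a) tensor \<Rightarrow> ('a \<Rightarrow> 'a \<Rightarrow> 'a \<Rightarrow> 'a) \<Rightarrow> 'a"
  where "sum_alg3 t f \<equiv> sum_alg t (\<lambda>xs. f (xs ! 0) (xs ! 1) (xs ! 2))"

abbreviation sum_ten2 ::
    "nat \<Rightarrow> ('k, 'a) tensor \<Rightarrow> ('a \<Rightarrow> 'a \<Rightarrow> ('k, 'a) tensor) \<Rightarrow> ('k, 'a) tensor"
  where "sum_ten2 m t f \<equiv> sum_ten m t (\<lambda>xs. f (xs ! 0) (xs ! 1))"

abbreviation sum_ten3 ::
    "nat \<Rightarrow> ('k, 'a) tensor \<Rightarrow> ('a \<Rightarrow> 'a \<Rightarrow> 'a \<Rightarrow> ('k, 'a) tensor) \<Rightarrow> ('k, 'a) tensor"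
  where "sum_ten3 m t f \<equiv> sum_ten m t (\<lambda>xs. f (xs ! 0) (xs ! 1) (xs ! 2))"

end


section \<open>Quasi-Hopf algebras\<close>

locale quasi_bialgebra = k_algebra scale
  for scale :: "'k::field \<Rightarrow> 'a::ring_1 \<Rightarrow> 'a" (infixr "*s" 75) +
  fixes \<Delta> :: "'a \<Rightarrow> ('k, 'a) tensor"
    and \<epsilon> :: "'a \<Rightarrow> 'k"
    and \<Phi> :: "('k, 'a) tensor"
  assumes \<Delta>_closed: "\<Delta> a \<in> tensor_power 2"
    and \<Delta>_add: "\<Delta> (a + b) = tadd 2 (\<Delta> a) (\<Delta> b)"
    and \<Delta>_scale: "\<Delta> (c *s a) = tscale 2 c (\<Delta> a)"
    and \<Delta>_mult: "\<Delta> (a * b) = tmult 2 (\<Delta> a) (\<Delta> b)"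
    and \<Delta>_one: "\<Delta> 1 = tone 2"
    and \<epsilon>_linear: "Vector_Spaces.linear scale (*) \<epsilon>"
    and \<epsilon>_mult: "\<epsilon> (a * b) = \<epsilon> a * \<epsilon> b"
    and \<epsilon>_one: "\<epsilon> 1 = 1"
    and \<Phi>_invertible: "tinvertible 3 \<Phi>"
    and quasi_coassociative:
      "tmult 3 (sum_ten2 3 (\<Delta> a) (\<lambda>x y. touter 1 2 (pure [x]) (\<Delta> y))) \<Phi>
       = tmult 3 \<Phi> (sum_ten2 3 (\<Delta> a) (\<lambda>x y. touter 2 1 (\<Delta> x) (pure [y])))"
    and pentagon:
      "tmult 4 (sum_ten3 4 \<Phi> (\<lambda>x y z. touter 2 2 (pure [x, y]) (\<Delta> z)))
               (sum_ten3 4 \<Phi> (\<lambda>x y z. touter 2 2 (\<Delta> x) (pure [y, z])))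
       = tmult 4 (tmult 4 (touter 1 3 (pure [1]) \<Phi>)
           (sum_ten3 4 \<Phi> (\<lambda>x y z. touter 1 3 (pure [x]) (touter 2 1 (\<Delta> y) (pure [z])))))
           (touter 3 1 \<Phi> (pure [1]))"
    and counit_left: "sum_alg2 (\<Delta> a) (\<lambda>x y. \<epsilon> x *s y) = a"
    and counit_right: "sum_alg2 (\<Delta> a) (\<lambda>x y. \<epsilon> y *s x) = a"
    and counit_\<Phi>: "sum_ten3 2 \<Phi> (\<lambda>x y z. tscale 2 (\<epsilon> y) (pure [x, z])) = tone 2"
begin

definition \<Phi>inv :: "('k, 'a) tensor"
  where "\<Phi>inv = tinverse 3 \<Phi>"

definition \<Delta>cop :: "'a \<Rightarrow> ('k, 'a) tensor"
  where "\<Delta>cop a = sum_ten2 2 (\<Delta> a) (\<lambda>x y. pure [y, x])"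

end

locale quasi_hopf_algebra = quasi_bialgebra scale \<Delta> \<epsilon> \<Phi>
  for scale :: "'k::field \<Rightarrow> 'a::ring_1 \<Rightarrow> 'a" (infixr "*s" 75)
    and \<Delta> :: "'a \<Rightarrow> ('k, 'a) tensor"
    and \<epsilon> :: "'a \<Rightarrow> 'k"
    and \<Phi> :: "('k, 'a) tensor" +
  fixes S :: "'a \<Rightarrow> 'a"
    and \<alpha> \<beta> :: 'a
  assumes S_linear: "Vector_Spaces.linear scale scale S"
    and S_mult: "S (a * b) = S b * S a"
    and S_one: "S 1 = 1"
    and S_bij: "bij S"
    and antipode_\<alpha>: "sum_alg2 (\<Delta> a) (\<lambda>x y. S x * \<alpha> * y) = \<epsilon> a *s \<alpha>"
    and antipode_\<beta>: "sum_alg2 (\<Delta> a) (\<lambda>x y. x * \<beta> * S y) = \<epsilon> a *s \<beta>"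
    and antipode_\<Phi>: "sum_alg3 \<Phi> (\<lambda>x y z. x * \<beta> * S y * \<alpha> * z) = 1"
    and antipode_\<Phi>inv: "sum_alg3 \<Phi>inv (\<lambda>x y z. S x * \<alpha> * y * \<beta> * S z) = 1"

text \<open>
  In the two axioms for \<open>\<Delta>\<close> on the legs of \<open>R\<close>, \<open>s, t\<close> are the components of \<open>R\<close>, \<open>X, Y, Z\<close> those
  of \<open>\<Phi>\<close> and \<open>x, y, z\<close> those of \<open>\<Phi>inv\<close>; primes mark further independent copies of the same sum.
\<close>

locale quasitriangular_quasi_hopf_algebra = quasi_hopf_algebra scale \<Delta> \<epsilon> \<Phi> S \<alpha> \<beta>
  for scale :: "'k::field \<Rightarrow> 'a::ring_1 \<Rightarrow> 'a" (infixr "*s" 75)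
    and \<Delta> :: "'a \<Rightarrow> ('k, 'a) tensor"
    and \<epsilon> :: "'a \<Rightarrow> 'k"
    and \<Phi> :: "('k, 'a) tensor"
    and S :: "'a \<Rightarrow> 'a"
    and \<alpha> \<beta> :: 'a +
  fixes R :: "('k, 'a) tensor"
  assumes R_invertible: "tinvertible 2 R"
    and R_cop: "tmult 2 (\<Delta>cop a) R = tmult 2 R (\<Delta> a)"
    and hexagon_left:
      "sum_ten2 3 R (\<lambda>s t. touter 2 1 (\<Delta> s) (pure [t])) =
       sum_ten3 3 \<Phi> (\<lambda>X Y Z.
       sum_ten3 3 \<Phi>inv (\<lambda>x y z.
       sum_ten3 3 \<Phi> (\<lambda>X' Y' Z'.
       sum_ten2 3 R (\<lambda>s t.
       sum_ten2 3 R (\<lambda>s' t'.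
         pure [Y * s * x * X', Z * z * s' * Y', X * t * y * t' * Z'])))))"
    and hexagon_right:
      "sum_ten2 3 R (\<lambda>s t. touter 1 2 (pure [s]) (\<Delta> t)) =
       sum_ten3 3 \<Phi>inv (\<lambda>x y z.
       sum_ten3 3 \<Phi> (\<lambda>X Y Z.
       sum_ten3 3 \<Phi>inv (\<lambda>x' y' z'.
       sum_ten2 3 R (\<lambda>s t.
       sum_ten2 3 R (\<lambda>s' t'.
         pure [z * s * Y * s' * x', x * X * t' * y', y * t * Z * z'])))))"
begin

definition Rinv :: "('k, 'a) tensor"
  where "Rinv = tinverse 2 R"

definition drinfeld_element :: 'a
  where "drinfeld_element =
    sum_alg3 \<Phi>inv (\<lambda>x y z. sum_alg2 R (\<lambda>s t. S (y * \<beta> * S z) * S t * \<alpha> * s * x))"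

definition hat_\<alpha> :: 'a
  where "hat_\<alpha> = sum_alg2 Rinv (\<lambda>s t. S s * \<alpha> * t)"

definition check_\<alpha> :: 'a
  where "check_\<alpha> = sum_alg2 R (\<lambda>s t. S t * \<alpha> * s)"

definition hat_u :: 'a
  where "hat_u = sum_alg3 \<Phi> (\<lambda>X Y Z. S Z * hat_\<alpha> * Y * inv S \<beta> * inv S X)"

definition check_u :: 'a
  where "check_u = sum_alg3 \<Phi> (\<lambda>X Y Z. S Z * check_\<alpha> * Y * inv S \<beta> * inv S X)"

end

text \<open>Two-sided invertibility and inverses in a possibly noncommutative ring.\<close>

definition invertible_elem :: "'a::ring_1 \<Rightarrow> bool"
  where "invertible_elem a \<longleftrightarrow> (\<exists>b. a * b = 1 \<and> b * a = 1)"

definition inverse_elem :: "'a::ring_1 \<Rightarrow> 'a"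
  where "inverse_elem a = (THE b. a * b = 1 \<and> b * a = 1)"

end

(*
  Put S' = S^-1. If gamma satisfies S(a_2) gamma a_1 = eps(a) gamma for all a, then
  U = S(Z) gamma Y S'(beta) S'(X) satisfies S(a) U = U S'(a), by quasi-coassociativity, and
  U S'(alpha) = gamma, by the pentagon axiom. Since R intertwines Delta and Delta^cop, this applies
  to both check_alpha and hat_alpha. The properties of check_u imply S(hat_alpha) check_u = alpha,
  hence S(hat_u) check_u = 1, and the identity for u. For the other product, e = check_u S(hat_u) is
  central because check_u a = S^2(a) check_u and S(hat_u) S^2(a) = a S(hat_u), and it satisfies
  e check_alpha = check_alpha; undoing R gives e alpha = alpha, so e = 1 by the identity X beta S(Y) alpha Z = 1.

  Equations between tensors enter only through their values under multilinear functions.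
*)
theory Submission
  imports Defs
begin

section \<open>Linear extension and evaluation of tensors\<close>

text \<open>The coopposite algebra has the antipode S^-1, with elements S^-1(\<alpha>) and
  S^-1(\<beta>). Twisting by R, or by the inverse of R with its legs exchanged, makes S a second
  candidate, with hat_alpha or check_alpha in place of \<alpha>. U is Drinfel'd's element comparing
  two antipodes, and S(a) U = U S^-1(a) says that it carries one to the other. Only the
  \<alpha>-half of the candidate enters the construction, so U does not come with an inverse. The
  two comparison elements are therefore played against each other, and since A is noncommutative the
  second product needs an argument of its own.

  The identity U S^-1(\<alpha>) = gamma is obtained by collapsing coproducts with the antipode
  identities. This leaves counits on the outer legs of \<Phi>, whereas the axiom speaks of the
  middle leg; the outer legs follow from the pentagon by cancelling a factor \<Phi>.

  Sums over tensors are evaluated on one fixed representative, so that nested sums can be reordered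
  freely; multilinearity is asked for only where an equation between tensors is applied.\<close>

definition lext ::
    "('k::field \<Rightarrow> 'v::ab_group_add \<Rightarrow> 'v) \<Rightarrow> ('x \<Rightarrow> 'v) \<Rightarrow> ('x \<Rightarrow>\<^sub>0 'k) \<Rightarrow> 'v"
  where "lext sc f p = (\<Sum>x\<in>Poly_Mapping.keys p. sc (Poly_Mapping.lookup p x) (f x))"

context vector_space
begin

text \<open>Cancellation can make the support of a sum smaller than the union of the supports; a
  common finite index set allows termwise comparison.\<close>

lemma lext_superset:
  assumes "finite A" "Poly_Mapping.keys p \<subseteq> A"
  shows "lext scale f p = (\<Sum>x\<in>A. scale (Poly_Mapping.lookup p x) (f x))"
  unfolding lext_def
  by (rule sum.mono_neutral_left) (use assms in \<open>auto simp: in_keys_iff\<close>)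

lemma lext_add: "lext scale f (p + q) = lext scale f p + lext scale f q"
proof -
  let ?A = "Poly_Mapping.keys p \<union> Poly_Mapping.keys q"
  have "Poly_Mapping.keys (p + q) \<subseteq> ?A"
    by (rule Poly_Mapping.keys_add)
  then show ?thesis
    by (simp add: lext_superset[of ?A] lookup_add scale_left_distrib sum.distrib)
qed

lemma keys_fscale: "Poly_Mapping.keys (fscale c p) \<subseteq> Poly_Mapping.keys p"
  by (auto simp: in_keys_iff lookup_fscale)

lemma lext_fscale: "lext scale f (fscale c p) = scale c (lext scale f p)"
  using keys_fscale[of c p]
  by (simp add: lext_superset[of "Poly_Mapping.keys p"] lookup_fscale scale_sum_right)

lemma lext_minus: "lext scale f (p - q) = lext scale f p - lext scale f q"
proof -
  have "lext scale f p = lext scale f (p - q + q)"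
    by simp
  then show ?thesis
    unfolding lext_add by (simp add: algebra_simps)
qed

lemma lext_zero: "lext scale f 0 = 0"
  by (simp add: lext_def)

lemma lext_single: "lext scale f (Poly_Mapping.single x c) = scale c (f x)"
  by (simp add: lext_superset[of "{x}"])

lemma lext_sum: "lext scale f (\<Sum>i\<in>I. p i) = (\<Sum>i\<in>I. lext scale f (p i))"
  by (induction I rule: infinite_finite_induct) (simp_all add: lext_zero lext_add)

lemma lext_cong:
  assumes "\<And>x. x \<in> Poly_Mapping.keys p \<Longrightarrow> f x = g x"
  shows "lext scale f p = lext scale g p"
  unfolding lext_def using assms by simp

lemma lext_lext: "lext scale f (lext fscale g p) = lext scale (\<lambda>x. lext scale f (g x)) p"
proof -
  have "lext fscale g p = (\<Sum>x\<in>Poly_Mapping.keys p. fscale (Poly_Mapping.lookup p x) (g x))"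
    by (rule lext_def)
  then have "lext scale f (lext fscale g p) =
      (\<Sum>x\<in>Poly_Mapping.keys p. scale (Poly_Mapping.lookup p x) (lext scale f (g x)))"
    by (simp only: lext_sum lext_fscale)
  then show ?thesis
    by (simp only: lext_def[of _ _ p])
qed

lemma lext_swap: "lext scale (\<lambda>x. lext scale (f x) q) p = lext scale (\<lambda>y. lext scale (\<lambda>x. f x y) p) q"
  unfolding lext_def scale_sum_right
  by (subst sum.swap) (simp add: mult.commute)

lemma lext_mem_subspace:
  assumes "subspace W" "\<And>x. x \<in> Poly_Mapping.keys p \<Longrightarrow> f x \<in> W"
  shows "lext scale f p \<in> W"
  unfolding lext_def using assms by (intro subspace_sum subspace_scale) auto

text \<open>The descent principle. With \<open>W\<close> zero it makes maps into the algebra well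
  defined on cosets; with \<open>W\<close> the span of the relations it does so for maps between
  tensor powers.\<close>

lemma lext_span_mem_subspace:
  assumes "subspace W" "\<And>r. r \<in> B \<Longrightarrow> lext scale f r \<in> W" "p \<in> free.span B"
  shows "lext scale f p \<in> W"
  using assms(3)
proof (induction rule: free.span_induct_alt)
  case base
  then show ?case
    by (simp add: lext_zero subspace_0[OF assms(1)])
next
  case (step c x y)
  then show ?case
    by (simp add: lext_add lext_fscale subspace_add[OF assms(1)] subspace_scale[OF assms(1)] assms(2))
qed

end

lemma fscale_single: "fscale c (Poly_Mapping.single z d) = Poly_Mapping.single z (c * d)"
  by (rule poly_mapping_eqI) (simp add: lookup_fscale lookup_single when_def)

text \<open>As an iterated linear extension, \<open>fbilinear\<close> is visibly linear in its first
  argument, and through \<open>lext_swap\<close> in its second.\<close>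

lemma fbilinear_eq_lext:
  fixes p :: "'x \<Rightarrow>\<^sub>0 'k::field"
  shows "fbilinear h p q = lext fscale (\<lambda>x. lext fscale (\<lambda>y. Poly_Mapping.single (h x y) 1) q) p"
  by (simp add: fbilinear_def lext_def free.scale_sum_right fscale_single)

section \<open>Multilinear maps, cosets of formal combinations, and evaluation\<close>

context k_algebra
begin

abbreviation lin :: "('a \<Rightarrow> 'a) \<Rightarrow> bool"
  where "lin \<equiv> Vector_Spaces.linear (*s) (*s)"

lemma linI:
  assumes "\<And>a b. f (a + b) = f a + f b" "\<And>c a. f (c *s a) = c *s f a"
  shows "lin f"
  using assms by unfold_locales auto

lemma lin_add: "lin f \<Longrightarrow> f (a + b) = f a + f b"
  and lin_scale: "lin f \<Longrightarrow> f (c *s a) = c *s f a"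
  by (auto simp: Vector_Spaces.linear_def module_hom.add module_hom.scale)

definition multilinear :: "nat \<Rightarrow> ('a list \<Rightarrow> 'a) \<Rightarrow> bool"
  where "multilinear n f \<longleftrightarrow>
    (\<forall>xs ys. length xs + 1 + length ys = n \<longrightarrow> lin (\<lambda>a. f (xs @ a # ys)))"

text \<open>Closedness is part of the notion because \<open>tadd\<close> and \<open>tscale\<close>
  are unions over cosets and behave linearly only on elements of the tensor power.\<close>

definition tlin :: "nat \<Rightarrow> ('a \<Rightarrow> ('k, 'a) tensor) \<Rightarrow> bool"
  where "tlin m F \<longleftrightarrow> (\<forall>a. F a \<in> tensor_power m)
    \<and> (\<forall>a b. F (a + b) = tadd m (F a) (F b)) \<and> (\<forall>c a. F (c *s a) = tscale m c (F a))"

definition tmultilinear :: "nat \<Rightarrow> nat \<Rightarrow> ('a list \<Rightarrow> ('k, 'a) tensor) \<Rightarrow> bool"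
  where "tmultilinear n m F \<longleftrightarrow> (\<forall>xs. length xs = n \<longrightarrow> F xs \<in> tensor_power m)
    \<and> (\<forall>xs ys. length xs + 1 + length ys = n \<longrightarrow> tlin m (\<lambda>a. F (xs @ a # ys)))"

lemma multilinear_relationsE:
  assumes "r \<in> multilinear_relations n"
  obtains (add) xs a b ys where "length xs + 1 + length ys = n"
      "r = Poly_Mapping.single (xs @ (a + b) # ys) 1
        - Poly_Mapping.single (xs @ a # ys) 1 - Poly_Mapping.single (xs @ b # ys) 1"
    | (scale) xs c a ys where "length xs + 1 + length ys = n"
      "r = Poly_Mapping.single (xs @ (c *s a) # ys) 1
        - fscale c (Poly_Mapping.single (xs @ a # ys) 1)"
  using assms unfolding multilinear_relations_def
  by (elim UnE CollectE exE conjE) metis+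

lemma formal_add: "p \<in> formal n \<Longrightarrow> q \<in> formal n \<Longrightarrow> p + q \<in> formal n"
  unfolding formal_def using Poly_Mapping.keys_add[of p q] by blast

lemma formal_fscale: "p \<in> formal n \<Longrightarrow> fscale c p \<in> formal n"
  unfolding formal_def using keys_fscale[of c p] by blast

lemma subspace_formal: "free.subspace (formal n)"
  by (rule free.subspaceI) (auto simp: formal_add formal_fscale, simp add: formal_def)

lemma formal_single: "length xs = n \<Longrightarrow> Poly_Mapping.single xs c \<in> formal n"
  by (simp add: formal_def)

lemma formal_lext:
  "p \<in> formal n \<Longrightarrow> (\<And>xs. length xs = n \<Longrightarrow> f xs \<in> formal m) \<Longrightarrow> lext fscale f p \<in> formal m"
  by (rule free.lext_mem_subspace[OF subspace_formal]) (auto simp: formal_def)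

lemma formal_fbilinear:
  assumes "p \<in> formal m" "q \<in> formal n"
    and "\<And>xs ys. length xs = m \<Longrightarrow> length ys = n \<Longrightarrow> length (h xs ys) = l"
  shows "fbilinear h p q \<in> formal l"
  unfolding fbilinear_eq_lext
  by (rule formal_lext[OF assms(1)], rule formal_lext[OF assms(2)])
    (simp add: formal_single assms(3))

lemma tclass_iff:
  "p \<in> formal n \<Longrightarrow>
    q \<in> tclass n p \<longleftrightarrow> q \<in> formal n \<and> p - q \<in> free.span (multilinear_relations n)"
  by (auto simp: tclass_def tensor_rel_def)

lemma tclass_eqI:
  assumes "p \<in> formal n" "q \<in> formal n" "p - q \<in> free.span (multilinear_relations n)"
  shows "tclass n p = tclass n q"
proof -
  have "p - r \<in> free.span (multilinear_relations n) \<longleftrightarrow>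
      q - r \<in> free.span (multilinear_relations n)" for r
    using free.span_diff[OF _ assms(3), of "p - r"] free.span_add[OF _ assms(3), of "q - r"]
    by (auto simp: algebra_simps)
  then show ?thesis
    using assms by (auto simp: tclass_iff)
qed

lemma tclass_self: "p \<in> formal n \<Longrightarrow> p \<in> tclass n p"
  by (simp add: tclass_iff free.span_zero)

lemma tclass_closed: "p \<in> formal n \<Longrightarrow> tclass n p \<in> tensor_power n"
  by (auto simp: tclass_def tensor_power_def quotient_def)

lemma tensor_powerE:
  assumes "t \<in> tensor_power n"
  obtains p where "p \<in> formal n" "t = tclass n p"
  using assms by (auto simp: tclass_def tensor_power_def quotient_def)

lemma tclass_of_mem:
  assumes "t \<in> tensor_power n" "p \<in> t"
  shows "p \<in> formal n \<and> t = tclass n p"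
  by (metis assms tclass_eqI tclass_iff tensor_powerE)

lemma tclass_some:
  assumes "t \<in> tensor_power n"
  shows "(SOME p. p \<in> t) \<in> formal n \<and> tclass n (SOME p. p \<in> t) = t"
  using assms by (metis someI tclass_of_mem tclass_self tensor_powerE)

text \<open>
  In contrast to \<open>sum_alg\<close>, a representative is fixed once and for all, so that \<open>ev\<close> commutes with
  linear operations and with itself without any assumption of multilinearity.
\<close>

definition ev :: "('k, 'a) tensor \<Rightarrow> ('a list \<Rightarrow> 'a) \<Rightarrow> 'a"
  where "ev t f = lext scale f (SOME p. p \<in> t)"

abbreviation "ev2 t f \<equiv> ev t (\<lambda>xs. f (xs ! 0) (xs ! 1))"
abbreviation "ev3 t f \<equiv> ev t (\<lambda>xs. f (xs ! 0) (xs ! 1) (xs ! 2))"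

lemma ev_add: "ev t (\<lambda>xs. f xs + g xs) = ev t f + ev t g"
  by (simp add: ev_def lext_def scale_right_distrib sum.distrib)

lemma ev_scale: "ev t (\<lambda>xs. c *s f xs) = c *s ev t f"
  by (simp add: ev_def lext_def scale_sum_right mult.commute)

lemma ev_mult_left: "ev t (\<lambda>xs. c * f xs) = c * ev t f"
  by (simp add: ev_def lext_def sum_distrib_left scale_mult_right)

lemma ev_mult_right: "ev t (\<lambda>xs. f xs * c) = ev t f * c"
  by (simp add: ev_def lext_def sum_distrib_right scale_mult_left)

lemma ev_swap: "ev s (\<lambda>xs. ev t (\<lambda>ys. f xs ys)) = ev t (\<lambda>ys. ev s (\<lambda>xs. f xs ys))"
  unfolding ev_def by (rule lext_swap)

lemma ev_lin:
  assumes "lin h"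
  shows "ev t (\<lambda>xs. h (f xs)) = h (ev t f)"
proof -
  interpret h: Vector_Spaces.linear "(*s)" "(*s)" h
    by fact
  show ?thesis
    by (simp add: ev_def lext_def h.sum h.scale)
qed

text \<open>The fixed representative has only tuples of length \<open>n\<close> as keys. This is
  what makes list indexing and slotwise products computable inside a sum.\<close>

lemma ev_cong:
  assumes "t \<in> tensor_power n" "\<And>xs. length xs = n \<Longrightarrow> f xs = g xs"
  shows "ev t f = ev t g"
  unfolding ev_def using assms(2) tclass_some[OF assms(1)]
  by (intro lext_cong) (auto simp: formal_def)

lemma
  assumes "multilinear n f" "length xs + 1 + length ys = n"
  shows multilinear_add: "f (xs @ (a + b) # ys) = f (xs @ a # ys) + f (xs @ b # ys)"
    and multilinear_scale: "f (xs @ (c *s a) # ys) = c *s f (xs @ a # ys)"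
  using lin_add[of "\<lambda>a. f (xs @ a # ys)"] lin_scale[of "\<lambda>a. f (xs @ a # ys)"] assms
  unfolding multilinear_def by blast+

lemma lext_relation:
  assumes "multilinear n f" "r \<in> multilinear_relations n"
  shows "lext scale f r = 0"
  using assms
  unfolding multilinear_relations_def
  by (auto simp: lext_minus lext_single lext_fscale multilinear_add[of n] multilinear_scale[of n])

lemma lext_tclass:
  assumes "multilinear n f" "p \<in> formal n" "q \<in> tclass n p"
  shows "lext scale f q = lext scale f p"
proof -
  \<comment> \<open>Equality is phrased as membership in the zero subspace, the form required by the
    descent principle.\<close>
  have "lext scale f (p - q) \<in> {0}"
  proof (rule lext_span_mem_subspace)
    show "p - q \<in> free.span (multilinear_relations n)"
      using assms by (simp add: tclass_iff)
  qed (use assms lext_relation in \<open>auto intro: subspace_single_0\<close>)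
  then show ?thesis
    by (simp add: lext_minus)
qed

lemma ev_tclass: "multilinear n f \<Longrightarrow> p \<in> formal n \<Longrightarrow> ev (tclass n p) f = lext scale f p"
  unfolding ev_def by (rule lext_tclass) (auto intro: someI tclass_self)

text \<open>The bridge from the definitions to \<open>ev\<close>: a multilinear \<open>f\<close>
  takes a single value on the whole coset, so \<open>the_elem\<close> is applied to a
  singleton.\<close>

lemma sum_alg_eq_ev:
  assumes "t \<in> tensor_power n" "multilinear n f"
  shows "sum_alg t f = ev t f"
proof -
  obtain p where p: "p \<in> formal n" "t = tclass n p"
    using assms tensor_powerE by blast
  have "lext scale f ` t = (\<lambda>_. lext scale f p) ` t"
    using lext_tclass[OF assms(2) p(1)] p(2) by (intro image_cong) auto
  also have "\<dots> = {lext scale f p}"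
    using tclass_self[OF p(1)] p(2) by auto
  finally have "the_elem (lext scale f ` t) = lext scale f p"
    by simp
  then show ?thesis
    unfolding sum_alg_def lext_def[symmetric] p(2) ev_tclass[OF assms(2) p(1)] .
qed

text \<open>Supplies multilinearity of an inner sum in the outer variables, as needed to evaluate
  double sums.\<close>

lemma multilinear_ev:
  assumes "t \<in> tensor_power n" "\<And>zs. length zs = n \<Longrightarrow> multilinear m (\<lambda>xs. f xs zs)"
  shows "multilinear m (\<lambda>xs. ev t (f xs))"
  unfolding multilinear_def
proof (intro allI impI linI)
  fix xs ys :: "'a list" and a b c
  assume len: "length xs + 1 + length ys = m"
  show "ev t (f (xs @ (a + b) # ys)) = ev t (f (xs @ a # ys)) + ev t (f (xs @ b # ys))"
    unfolding ev_add[symmetric]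
    using multilinear_add[OF assms(2) len] by (rule ev_cong[OF assms(1)])
  show "ev t (f (xs @ (c *s a) # ys)) = c *s ev t (f (xs @ a # ys))"
    unfolding ev_scale[symmetric]
    using multilinear_scale[OF assms(2) len] by (rule ev_cong[OF assms(1)])
qed

section \<open>Tensor operations computed on representatives\<close>

lemma pure_closed: "length xs = n \<Longrightarrow> pure xs \<in> tensor_power n"
  unfolding pure_def by (auto intro: tclass_closed formal_single)

lemma ev_pure: "multilinear (length xs) f \<Longrightarrow> ev (pure xs) f = f xs"
  unfolding pure_def by (simp add: ev_tclass formal_single lext_single)

text \<open>Operations on tensors are unions over all representatives; once the value is independent
  of the choice, the union collapses to it.\<close>

lemma UN_constant_eq: "p \<in> A \<Longrightarrow> (\<And>q. q \<in> A \<Longrightarrow> g q = c) \<Longrightarrow> (\<Union>q\<in>A. g q) = c"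
  by auto

lemma tadd_tclass:
  assumes "p \<in> formal n" "q \<in> formal n"
  shows "tadd n (tclass n p) (tclass n q) = tclass n (p + q)"
  unfolding tadd_def
proof (intro UN_constant_eq[OF tclass_self])
  fix p' q' assume "p' \<in> tclass n p" "q' \<in> tclass n q"
  then show "tclass n (p' + q') = tclass n (p + q)"
    using assms free.span_add[of "p - p'" "multilinear_relations n" "q - q'"]
    by (intro tclass_eqI[symmetric]) (auto simp: tclass_iff formal_add algebra_simps)
qed (use assms in auto)

lemma tscale_tclass:
  assumes "p \<in> formal n"
  shows "tscale n c (tclass n p) = tclass n (fscale c p)"
  unfolding tscale_def
proof (intro UN_constant_eq[OF tclass_self])
  fix p' assume "p' \<in> tclass n p"
  then show "tclass n (fscale c p') = tclass n (fscale c p)"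
    using assms free.span_scale[of "p - p'" "multilinear_relations n" c]
    by (intro tclass_eqI[symmetric]) (auto simp: tclass_iff formal_fscale free.scale_right_diff_distrib)
qed (use assms in auto)

lemma tscale_closed: "t \<in> tensor_power n \<Longrightarrow> tscale n c t \<in> tensor_power n"
  by (metis formal_fscale tclass_closed tensor_powerE tscale_tclass)

lemma ev_tadd:
  assumes "multilinear n f" "s \<in> tensor_power n" "t \<in> tensor_power n"
  shows "ev (tadd n s t) f = ev s f + ev t f"
  using assms
  by (auto elim!: tensor_powerE simp: tadd_tclass ev_tclass formal_add lext_add)

lemma ev_tscale:
  assumes "multilinear n f" "t \<in> tensor_power n"
  shows "ev (tscale n c t) f = c *s ev t f"
  using assms
  by (auto elim!: tensor_powerE simp: tscale_tclass ev_tclass formal_fscale lext_fscale)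

lemma lin_ev_tlin: "multilinear m f \<Longrightarrow> tlin m F \<Longrightarrow> lin (\<lambda>a. ev (F a) f)"
  by (rule linI) (auto simp: tlin_def ev_tadd ev_tscale)

text \<open>Both claims rest on one representative of \<open>sum_ten m t F\<close>, the linear
  extension of the chosen representatives \<open>Q xs\<close> of \<open>F xs\<close>.
  \<open>Q\<close> itself is multilinear only modulo the relations: on a relation it gives a
  difference of two representatives of one coset, which is enough for descent.\<close>

lemma sum_ten_closed_ev:
  assumes "t \<in> tensor_power n" "tmultilinear n m F"
  shows "sum_ten m t F \<in> tensor_power m"
    and "multilinear m f \<Longrightarrow> ev (sum_ten m t F) f = ev t (\<lambda>xs. ev (F xs) f)"
proof -
  define Q where "Q xs = (SOME q. q \<in> F xs)" for xs
  have Q: "Q xs \<in> formal m" "tclass m (Q xs) = F xs" if "length xs = n" for xs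
    using that tclass_some assms(2) by (auto simp: Q_def tmultilinear_def)
  have mem: "x - y \<in> free.span (multilinear_relations m)"
    if "tclass m x = tclass m y" "x \<in> formal m" "y \<in> formal m" for x y
    using that tclass_self tclass_iff by blast
  have rel: "lext fscale Q r \<in> free.span (multilinear_relations m)"
    if "r \<in> multilinear_relations n" for r
  proof -
    from that show ?thesis
    proof (cases rule: multilinear_relationsE)
      case (add xs a b ys)
      let ?q = "\<lambda>a. Q (xs @ a # ys)"
      have q: "?q a \<in> formal m" "tclass m (?q a) = F (xs @ a # ys)" for a
        using Q add by auto
      have "tclass m (?q (a + b)) = tclass m (?q a + ?q b)"
        using assms(2) add(1) unfolding tmultilinear_def tlin_def
        by (simp add: q tadd_tclass[symmetric])
      from mem[OF this q(1) formal_add[OF q(1) q(1)]] show ?thesis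
        by (simp only: add(2) free.lext_minus free.lext_single free.lext_add free.scale_one diff_diff_add)
    next
      case (scale xs c a ys)
      let ?q = "\<lambda>a. Q (xs @ a # ys)"
      have q: "?q a \<in> formal m" "tclass m (?q a) = F (xs @ a # ys)" for a
        using Q scale by auto
      have "tclass m (?q (c *s a)) = tclass m (fscale c (?q a))"
        using assms(2) scale(1) unfolding tmultilinear_def tlin_def
        by (simp add: q tscale_tclass[symmetric])
      from mem[OF this q(1) formal_fscale[OF q(1)]] show ?thesis
        by (simp add: scale(2) free.lext_minus free.lext_single free.lext_fscale)
    qed
  qed
  obtain p where p: "p \<in> formal n" "t = tclass n p"
    using assms tensor_powerE by blast
  have form: "lext fscale Q p' \<in> formal m" if "p' \<in> formal n" for p'
    using that Q by (intro formal_lext)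
  have eq: "sum_ten m t F = tclass m (lext fscale Q p)"
    unfolding sum_ten_def lext_def[symmetric] Q_def[symmetric] p(2)
  proof (intro UN_constant_eq[OF tclass_self])
    fix p' assume p': "p' \<in> tclass n p"
    have "lext fscale Q (p - p') \<in> free.span (multilinear_relations m)"
      by (rule free.lext_span_mem_subspace[OF free.subspace_span rel])
        (use p p' tclass_iff in auto)
    then show "tclass m (lext fscale Q p') = tclass m (lext fscale Q p)"
      using p p' form by (intro tclass_eqI[symmetric]) (auto simp: tclass_iff free.lext_minus)
  qed (use p in auto)
  show "sum_ten m t F \<in> tensor_power m"
    unfolding eq using form p by (intro tclass_closed)
  assume f: "multilinear m f"
  have "multilinear n (\<lambda>xs. ev (F xs) f)"
    using assms(2) f lin_ev_tlin unfolding multilinear_def[of n] tmultilinear_def by blast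
  then have "ev t (\<lambda>xs. ev (F xs) f) = lext scale (\<lambda>xs. lext scale f (Q xs)) p"
    unfolding p(2) using p(1) by (simp add: ev_tclass) (simp add: ev_def Q_def)
  then show "ev (sum_ten m t F) f = ev t (\<lambda>xs. ev (F xs) f)"
    unfolding eq using form p f by (simp add: ev_tclass lext_lext)
qed

text \<open>
  Slotwise linearity of \<open>h\<close> holds for concatenation and for the componentwise product; it is
  what makes the bilinear extension of \<open>h\<close> descend to tensors.
\<close>

definition slotwise_linear :: "nat \<Rightarrow> nat \<Rightarrow> ('a list \<Rightarrow> 'a list) \<Rightarrow> bool"
  where "slotwise_linear m l h \<longleftrightarrow> (\<forall>xs. length xs = m \<longrightarrow> length (h xs) = l)
    \<and> (\<forall>xs ys. length xs + 1 + length ys = m \<longrightarrow>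
      (\<exists>us g vs. lin g \<and> length us + 1 + length vs = l \<and> (\<forall>a. h (xs @ a # ys) = us @ g a # vs)))"

lemma slotwise_linearE:
  assumes "slotwise_linear m l h" "length xs + 1 + length ys = m"
  obtains us g vs where "lin g" "length us + 1 + length vs = l"
    "\<And>a. h (xs @ a # ys) = us @ g a # vs"
  using assms unfolding slotwise_linear_def by metis

lemma multilinear_slotwise_linear:
  assumes "slotwise_linear m l h" "multilinear l f"
  shows "multilinear m (\<lambda>xs. f (h xs))"
  unfolding multilinear_def
proof (intro allI impI)
  fix xs ys :: "'a list"
  assume len: "length xs + 1 + length ys = m"
  obtain us g vs where g: "lin g" "length us + 1 + length vs = l"
      "\<And>a. h (xs @ a # ys) = us @ g a # vs"
    using slotwise_linearE[OF assms(1) len] by metis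
  then show "lin (\<lambda>a. f (h (xs @ a # ys)))"
    using assms(2)
    by (intro linI) (simp_all add: lin_add lin_scale multilinear_add[of l] multilinear_scale[of l])
qed

text \<open>The image of a generating relation is again a single generating relation of the same
  kind, with the entry in the varying slot transformed by \<open>g\<close>.\<close>

lemma slotwise_linear_relation:
  assumes "slotwise_linear m l h" "r \<in> multilinear_relations m"
  shows "lext fscale (\<lambda>xs. Poly_Mapping.single (h xs) 1) r \<in> free.span (multilinear_relations l)"
  using assms(2)
proof (cases rule: multilinear_relationsE)
  case (add xs a b ys)
  obtain us g vs where g: "lin g" "length us + 1 + length vs = l"
      "\<And>a. h (xs @ a # ys) = us @ g a # vs"
    using slotwise_linearE[OF assms(1) add(1)] by metis
  have "lext fscale (\<lambda>xs. Poly_Mapping.single (h xs) 1) r =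
      Poly_Mapping.single (us @ (g a + g b) # vs) 1
        - Poly_Mapping.single (us @ g a # vs) 1 - Poly_Mapping.single (us @ g b # vs) 1"
    by (simp add: add(2) g lin_add free.lext_minus free.lext_single)
  also have "\<dots> \<in> multilinear_relations l"
    unfolding multilinear_relations_def using g(2) by blast
  finally show ?thesis
    by (rule free.span_base)
next
  case (scale xs c a ys)
  obtain us g vs where g: "lin g" "length us + 1 + length vs = l"
      "\<And>a. h (xs @ a # ys) = us @ g a # vs"
    using slotwise_linearE[OF assms(1) scale(1)] by metis
  have "lext fscale (\<lambda>xs. Poly_Mapping.single (h xs) 1) r =
      Poly_Mapping.single (us @ (c *s g a) # vs) 1
        - fscale c (Poly_Mapping.single (us @ g a # vs) 1)"
    by (simp add: scale(2) g lin_scale free.lext_minus free.lext_single free.lext_fscale)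
  also have "\<dots> \<in> multilinear_relations l"
    unfolding multilinear_relations_def using g(2) by blast
  finally show ?thesis
    by (rule free.span_base)
qed

context
  fixes h :: "'a list \<Rightarrow> 'a list \<Rightarrow> 'a list" and m n l :: nat
  assumes h1: "\<And>ys. length ys = n \<Longrightarrow> slotwise_linear m l (\<lambda>xs. h xs ys)"
    and h2: "\<And>xs. length xs = m \<Longrightarrow> slotwise_linear n l (h xs)"
begin

lemma formal_fbilinear_slotwise:
  "p \<in> formal m \<Longrightarrow> q \<in> formal n \<Longrightarrow> fbilinear h p q \<in> formal l"
  using h2 by (intro formal_fbilinear) (auto simp: slotwise_linear_def)

text \<open>The arguments are replaced one at a time. In each case the difference is brought
  innermost, where the tuple in the other argument is fixed and slotwise linearity applies.\<close>

lemma tclass_fbilinear_cong: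
  assumes "p \<in> formal m" "q \<in> formal n" "p' \<in> tclass m p" "q' \<in> tclass n q"
  shows "tclass l (fbilinear h p' q') = tclass l (fbilinear h p q)"
proof -
  let ?L = "free.span (multilinear_relations l)"
  have formal: "p' \<in> formal m" "q' \<in> formal n"
    and diff: "p - p' \<in> free.span (multilinear_relations m)"
      "q - q' \<in> free.span (multilinear_relations n)"
    using assms by (simp_all add: tclass_iff)
  have "fbilinear h p q - fbilinear h p' q \<in> ?L"
    unfolding fbilinear_eq_lext free.lext_minus[symmetric]
  proof (subst free.lext_swap, rule free.lext_mem_subspace[OF free.subspace_span])
    fix ys assume "ys \<in> Poly_Mapping.keys q"
    then have "length ys = n"
      using assms(2) by (simp add: formal_def)
    then show "lext fscale (\<lambda>xs. Poly_Mapping.single (h xs ys) 1) (p - p') \<in> ?L"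
      using slotwise_linear_relation[OF h1]
      by (intro free.lext_span_mem_subspace[OF free.subspace_span _ diff(1)])
  qed
  moreover have "fbilinear h p' q - fbilinear h p' q' \<in> ?L"
  proof -
    have "fbilinear h p' q - fbilinear h p' q' =
        lext fscale (\<lambda>xs. lext fscale (\<lambda>ys. Poly_Mapping.single (h xs ys) 1) (q - q')) p'"
      unfolding fbilinear_eq_lext
      \<comment> \<open>In all three terms the swap puts the second argument outermost, where the
        extension is linear.\<close>
      by (subst (1 2 3) free.lext_swap) (simp add: free.lext_minus)
    also have "\<dots> \<in> ?L"
    proof (rule free.lext_mem_subspace[OF free.subspace_span])
      fix xs assume "xs \<in> Poly_Mapping.keys p'"
      then have "length xs = m"
        using formal by (simp add: formal_def)
      then show "lext fscale (\<lambda>ys. Poly_Mapping.single (h xs ys) 1) (q - q') \<in> ?L"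
        using slotwise_linear_relation[OF h2]
        by (intro free.lext_span_mem_subspace[OF free.subspace_span _ diff(2)])
    qed
    finally show ?thesis .
  qed
  ultimately have "(fbilinear h p q - fbilinear h p' q)
      + (fbilinear h p' q - fbilinear h p' q') \<in> ?L"
    by (rule free.span_add)
  then show ?thesis
    using assms formal
    by (intro tclass_eqI[symmetric] formal_fbilinear_slotwise) simp_all
qed

lemma UN_tclass_fbilinear:
  assumes "p \<in> formal m" "q \<in> formal n"
  shows "(\<Union>p'\<in>tclass m p. \<Union>q'\<in>tclass n q. tclass l (fbilinear h p' q')) =
    tclass l (fbilinear h p q)"
  using assms tclass_fbilinear_cong by (intro UN_constant_eq[OF tclass_self])

lemma ev_fbilinear:
  assumes "p \<in> formal m" "q \<in> formal n" "multilinear l f"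
  shows "ev (tclass l (fbilinear h p q)) f =
    ev (tclass m p) (\<lambda>xs. ev (tclass n q) (\<lambda>ys. f (h xs ys)))"
proof -
  have *: "ev (tclass n q) (\<lambda>ys. f (h xs ys)) = lext scale (\<lambda>ys. f (h xs ys)) q"
    if "length xs = m" for xs
    using multilinear_slotwise_linear[OF h2[OF that] assms(3)] assms(2) by (rule ev_tclass)
  have "multilinear m (\<lambda>xs. ev (tclass n q) (\<lambda>ys. f (h xs ys)))"
    using multilinear_slotwise_linear[OF h1 assms(3)]
    by (rule multilinear_ev[OF tclass_closed[OF assms(2)]])
  then have "ev (tclass m p) (\<lambda>xs. ev (tclass n q) (\<lambda>ys. f (h xs ys))) =
      lext scale (\<lambda>xs. ev (tclass n q) (\<lambda>ys. f (h xs ys))) p"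
    using assms(1) by (rule ev_tclass)
  also have "\<dots> = lext scale (\<lambda>xs. lext scale (\<lambda>ys. f (h xs ys)) q) p"
    using assms(1) * by (intro lext_cong) (simp add: formal_def)
  also have "\<dots> = lext scale f (fbilinear h p q)"
    unfolding fbilinear_eq_lext by (simp add: lext_lext lext_single)
  finally show ?thesis
    using assms by (simp add: ev_tclass formal_fbilinear_slotwise)
qed

end

section \<open>Componentwise and outer products of tensors\<close>

lemma lin_id: "lin (\<lambda>a. a)"
  and lin_times_left: "lin (\<lambda>a. x * a)"
  and lin_times_right: "lin (\<lambda>a. a * x)"
  by (auto intro!: linI simp: distrib_left distrib_right scale_mult_left scale_mult_right)

lemma slotwise_linearI:
  assumes "\<And>xs. length xs = m \<Longrightarrow> length (h xs) = l"
    and "\<And>xs ys. length xs + 1 + length ys = m \<Longrightarrow>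
      lin (g xs ys) \<and> length (us xs ys) + 1 + length (vs xs ys) = l
      \<and> (\<forall>a. h (xs @ a # ys) = us xs ys @ g xs ys a # vs xs ys)"
  shows "slotwise_linear m l h"
  unfolding slotwise_linear_def using assms by blast

lemma slotwise_linear_append:
  "length ys = n \<Longrightarrow> slotwise_linear m (m + n) (\<lambda>xs. xs @ ys)"
  "length xs = m \<Longrightarrow> slotwise_linear n (m + n) ((@) xs)"
  by (rule slotwise_linearI[where us = "\<lambda>us _. us" and g = "\<lambda>_ _ a. a" and vs = "\<lambda>_ vs. vs @ ys"])
    (auto simp: lin_id,
     rule slotwise_linearI[where us = "\<lambda>us _. xs @ us" and g = "\<lambda>_ _ a. a" and vs = "\<lambda>_ vs. vs"],
     auto simp: lin_id)

lemma slotwise_linear_map2: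
  assumes "length ys = n"
  shows "slotwise_linear n n (\<lambda>xs. map2 (*) xs ys)" "slotwise_linear n n (\<lambda>xs. map2 (*) ys xs)"
proof -
  \<comment> \<open>The fixed tuple is split at the position of the varying entry; \<open>v\<close>
    is the factor that multiplies this entry.\<close>
  have *: "\<exists>us v vs. ys = us @ v # vs \<and> length us = length xs \<and> length vs = length zs"
    if "length xs + 1 + length zs = n" for xs zs :: "'a list"
    using that assms
    by (intro exI[of _ "take (length xs) ys"] exI[of _ "ys ! length xs"]
        exI[of _ "drop (Suc (length xs)) ys"]) (simp add: id_take_nth_drop[symmetric])
  show "slotwise_linear n n (\<lambda>xs. map2 (*) xs ys)"
    unfolding slotwise_linear_def
  proof (intro conjI allI impI)
    fix xs zs :: "'a list" assume "length xs + 1 + length zs = n"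
    with *[OF this] obtain us v vs where "ys = us @ v # vs" "length us = length xs"
        "length vs = length zs" "length xs + 1 + length zs = n"
      by auto
    then show "\<exists>us g vs. lin g \<and> length us + 1 + length vs = n \<and>
        (\<forall>a. map2 (*) (xs @ a # zs) ys = us @ g a # vs)"
      by (intro exI[of _ "map2 (*) xs us"] exI[of _ "\<lambda>a. a * v"] exI[of _ "map2 (*) zs vs"])
        (simp add: lin_times_right)
  qed (simp add: assms)
  show "slotwise_linear n n (\<lambda>xs. map2 (*) ys xs)"
    unfolding slotwise_linear_def
  proof (intro conjI allI impI)
    fix xs zs :: "'a list" assume "length xs + 1 + length zs = n"
    with *[OF this] obtain us v vs where "ys = us @ v # vs" "length us = length xs"
        "length vs = length zs" "length xs + 1 + length zs = n"
      by auto
    then show "\<exists>us g vs. lin g \<and> length us + 1 + length vs = n \<and>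
        (\<forall>a. map2 (*) ys (xs @ a # zs) = us @ g a # vs)"
      by (intro exI[of _ "map2 (*) us xs"] exI[of _ "\<lambda>a. v * a"] exI[of _ "map2 (*) vs zs"])
        (simp add: lin_times_left)
  qed (simp add: assms)
qed

lemma tmult_tclass:
  assumes "p \<in> formal n" "q \<in> formal n"
  shows "tmult n (tclass n p) (tclass n q) = tclass n (fbilinear (map2 (*)) p q)"
    and "fbilinear (map2 (*)) p q \<in> formal n"
  unfolding tmult_def
  by (rule UN_tclass_fbilinear, simp_all add: slotwise_linear_map2 assms)
    (rule formal_fbilinear_slotwise[of n n n], simp_all add: slotwise_linear_map2 assms)

lemma
  assumes "s \<in> tensor_power n" "t \<in> tensor_power n"
  shows tmult_closed: "tmult n s t \<in> tensor_power n"
    and ev_tmult: "multilinear n f \<Longrightarrow>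
      ev (tmult n s t) f = ev s (\<lambda>xs. ev t (\<lambda>ys. f (map2 (*) xs ys)))"
proof -
  obtain p q where p: "p \<in> formal n" "s = tclass n p" and q: "q \<in> formal n" "t = tclass n q"
    using assms by (meson tensor_powerE)
  show "tmult n s t \<in> tensor_power n"
    using p q by (simp add: tmult_tclass tclass_closed)
  show "ev (tmult n s t) f = ev s (\<lambda>xs. ev t (\<lambda>ys. f (map2 (*) xs ys)))" if "multilinear n f"
    unfolding p(2) q(2) tmult_tclass(1)[OF p(1) q(1)]
    by (rule ev_fbilinear) (simp_all add: slotwise_linear_map2 p q that)
qed

lemma touter_tclass:
  assumes "p \<in> formal m" "q \<in> formal n"
  shows "touter m n (tclass m p) (tclass n q) = tclass (m + n) (fbilinear (@) p q)"
  unfolding touter_def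
  by (rule UN_tclass_fbilinear) (simp_all add: slotwise_linear_append assms)

lemma formal_fbilinear_append:
  "p \<in> formal m \<Longrightarrow> q \<in> formal n \<Longrightarrow> fbilinear (@) p q \<in> formal (m + n)"
  by (rule formal_fbilinear_slotwise) (simp_all add: slotwise_linear_append)

lemma
  assumes "s \<in> tensor_power m" "t \<in> tensor_power n"
  shows touter_closed: "m + n = l \<Longrightarrow> touter m n s t \<in> tensor_power l"
    and ev_touter: "multilinear (m + n) f \<Longrightarrow>
      ev (touter m n s t) f = ev s (\<lambda>xs. ev t (\<lambda>ys. f (xs @ ys)))"
proof -
  obtain p q where p: "p \<in> formal m" "s = tclass m p" and q: "q \<in> formal n" "t = tclass n q"
    using assms by (meson tensor_powerE)
  show "m + n = l \<Longrightarrow> touter m n s t \<in> tensor_power l"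
    using p q by (auto simp: touter_tclass intro: tclass_closed formal_fbilinear_append)
  show "ev (touter m n s t) f = ev s (\<lambda>xs. ev t (\<lambda>ys. f (xs @ ys)))" if "multilinear (m + n) f"
    unfolding p(2) q(2) touter_tclass[OF p(1) q(1)]
    by (rule ev_fbilinear) (simp_all add: slotwise_linear_append p q that)
qed

lemma tlin_touter_left:
  assumes "tlin m F" "t \<in> tensor_power n" "m + n = l"
  shows "tlin l (\<lambda>a. touter m n (F a) t)"
proof -
  obtain q where q: "q \<in> formal n" "t = tclass n q"
    using assms tensor_powerE by blast
  \<comment> \<open>Additivity and the scalar rule are proved jointly for two tensors; the zero
    class fills the place of the second one in the scalar rule.\<close>
  have zero: "tclass m 0 \<in> tensor_power m"
    by (simp add: tclass_closed formal_def)
  have "touter m n (tadd m s s') t = tadd (m + n) (touter m n s t) (touter m n s' t)"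
    and "touter m n (tscale m c s) t = tscale (m + n) c (touter m n s t)"
    if s: "s \<in> tensor_power m" "s' \<in> tensor_power m" for s s' c
  proof -
    obtain p p' where p: "p \<in> formal m" "s = tclass m p" "p' \<in> formal m" "s' = tclass m p'"
      using s by (meson tensor_powerE)
    have "fbilinear (@) (p + p') q = fbilinear (@) p q + fbilinear (@) p' q"
      "fbilinear (@) (fscale c p) q = fscale c (fbilinear (@) p q)"
      unfolding fbilinear_eq_lext by (simp_all add: free.lext_add free.lext_fscale)
    then show "touter m n (tadd m s s') t = tadd (m + n) (touter m n s t) (touter m n s' t)"
      and "touter m n (tscale m c s) t = tscale (m + n) c (touter m n s t)"
      using p q
      by (simp_all add: tadd_tclass tscale_tclass touter_tclass formal_add formal_fscale
          formal_fbilinear_append)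
  qed
  note add = this(1) and scale = this(2)[OF _ zero]
  show ?thesis
    using assms(1,2) add scale unfolding tlin_def assms(3)[symmetric] by (simp add: touter_closed)
qed

lemma tlin_touter_right:
  assumes "tlin n F" "s \<in> tensor_power m" "m + n = l"
  shows "tlin l (\<lambda>a. touter m n s (F a))"
proof -
  obtain p where p: "p \<in> formal m" "s = tclass m p"
    using assms tensor_powerE by blast
  have swap: "fbilinear (@) p q = lext fscale (\<lambda>ys. lext fscale (\<lambda>xs. Poly_Mapping.single (xs @ ys) 1) p) q"
    for q :: "'a list \<Rightarrow>\<^sub>0 'k"
    unfolding fbilinear_eq_lext by (rule free.lext_swap)
  have zero: "tclass n 0 \<in> tensor_power n"
    by (simp add: tclass_closed formal_def)
  have "touter m n s (tadd n t t') = tadd (m + n) (touter m n s t) (touter m n s t')"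
    and "touter m n s (tscale n c t) = tscale (m + n) c (touter m n s t)"
    if t: "t \<in> tensor_power n" "t' \<in> tensor_power n" for t t' c
  proof -
    obtain q q' where q: "q \<in> formal n" "t = tclass n q" "q' \<in> formal n" "t' = tclass n q'"
      using t by (meson tensor_powerE)
    have "fbilinear (@) p (q + q') = fbilinear (@) p q + fbilinear (@) p q'"
      "fbilinear (@) p (fscale c q) = fscale c (fbilinear (@) p q)"
      unfolding swap by (simp_all add: free.lext_add free.lext_fscale)
    then show "touter m n s (tadd n t t') = tadd (m + n) (touter m n s t) (touter m n s t')"
      and "touter m n s (tscale n c t) = tscale (m + n) c (touter m n s t)"
      using p q
      by (simp_all add: tadd_tclass tscale_tclass touter_tclass formal_add formal_fscale
          formal_fbilinear_append)
  qed
  note add = this(1) and scale = this(2)[OF _ zero]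
  show ?thesis
    using assms(1,2) add scale unfolding tlin_def assms(3)[symmetric] by (simp add: touter_closed)
qed

text \<open>The defining relations enter directly here: each of the two rules is a generator of the
  span.\<close>

lemma tlin_pure:
  assumes "length us + 1 + length vs = n"
  shows "tlin n (\<lambda>a. pure (us @ a # vs))"
proof -
  let ?s = "\<lambda>a. Poly_Mapping.single (us @ a # vs) (1::'k)"
  have formal: "?s a \<in> formal n" for a
    using assms by (simp add: formal_single)
  have pure: "pure (us @ a # vs) = tclass n (?s a)" for a
    using assms by (simp add: pure_def)
  have "?s (a + b) - (?s a + ?s b) \<in> free.span (multilinear_relations n)" for a b
    unfolding diff_diff_add[symmetric]
    by (rule free.span_base) (use assms in \<open>unfold multilinear_relations_def, blast\<close>)
  moreover have "?s (c *s a) - fscale c (?s a) \<in> free.span (multilinear_relations n)" for c a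
    by (rule free.span_base) (use assms in \<open>unfold multilinear_relations_def, blast\<close>)
  ultimately show ?thesis
    unfolding tlin_def pure using formal
    by (simp add: tclass_closed tadd_tclass tscale_tclass tclass_eqI formal_add formal_fscale)
qed

lemma tlin_tscale:
  assumes "tlin m F"
  shows "tlin m (\<lambda>a. tscale m c (F a))"
proof -
  have "tscale m c (tadd m s t) = tadd m (tscale m c s) (tscale m c t)"
    and "tscale m c (tscale m d s) = tscale m d (tscale m c s)"
    if st: "s \<in> tensor_power m" "t \<in> tensor_power m" for s t d
  proof -
    obtain p q where "p \<in> formal m" "s = tclass m p" "q \<in> formal m" "t = tclass m q"
      using st by (meson tensor_powerE)
    then show "tscale m c (tadd m s t) = tadd m (tscale m c s) (tscale m c t)"
      "tscale m c (tscale m d s) = tscale m d (tscale m c s)"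
      by (simp_all add: tadd_tclass tscale_tclass formal_add formal_fscale
          free.scale_right_distrib mult.commute)
  qed
  note * = this(1) this(2)[OF _ tclass_closed[of 0]]
  show ?thesis
    using assms *[unfolded formal_def] unfolding tlin_def by (simp add: tscale_closed)
qed

lemma tlin_tscale_scalar:
  assumes "t \<in> tensor_power m" "Vector_Spaces.linear scale (*) g"
  shows "tlin m (\<lambda>a. tscale m (g a) t)"
proof -
  interpret g: Vector_Spaces.linear scale "(*)" g
    by fact
  obtain p where "p \<in> formal m" "t = tclass m p"
    using assms tensor_powerE by blast
  then show ?thesis
    unfolding tlin_def
    by (simp add: tscale_closed tclass_closed tadd_tclass tscale_tclass formal_fscale g.add g.scale
        free.scale_left_distrib)
qed

section \<open>Tensor powers as rings: associativity, unit and inverses\<close>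

lemma map2_mult_assoc:
  "map2 (*) (map2 (*) xs ys) zs = map2 (*) xs (map2 (*) ys (zs :: 'a list))"
proof (induction xs arbitrary: ys zs)
  case (Cons x xs)
  then show ?case
    by (cases ys; cases zs) (simp_all add: mult.assoc)
qed simp

lemma tmult_assoc:
  assumes "s \<in> tensor_power n" "t \<in> tensor_power n" "u \<in> tensor_power n"
  shows "tmult n (tmult n s t) u = tmult n s (tmult n t u)"
proof -
  obtain p q r where pqr: "p \<in> formal n" "s = tclass n p" "q \<in> formal n" "t = tclass n q"
      "r \<in> formal n" "u = tclass n r"
    using assms by (meson tensor_powerE)
  have "fbilinear (map2 (*)) (fbilinear (map2 (*)) p q) r =
      fbilinear (map2 (*)) p (fbilinear (map2 (*)) q r)"
    unfolding fbilinear_eq_lext by (simp add: free.lext_lext free.lext_single map2_mult_assoc)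
  then show ?thesis
    using pqr by (simp add: tmult_tclass)
qed

lemma tmult_tone:
  assumes "t \<in> tensor_power n"
  shows "tmult n (tone n) t = t" "tmult n t (tone n) = t"
proof -
  obtain p where p: "p \<in> formal n" "t = tclass n p"
    using assms tensor_powerE by blast
  have id: "lext fscale (\<lambda>xs. Poly_Mapping.single xs 1) p = p"
    by (rule poly_mapping_eqI)
      (simp add: lext_def fscale_single lookup_sum lookup_single when_def in_keys_iff)
  have len: "length xs = n" if "xs \<in> Poly_Mapping.keys p" for xs
    using that p by (simp add: formal_def)
  have one: "map2 (*) (replicate n 1) xs = xs \<and> map2 (*) xs (replicate n 1) = xs"
    if "length xs = n" for xs :: "'a list"
    using that by (auto intro!: nth_equalityI)
  have "fbilinear (map2 (*)) (Poly_Mapping.single (replicate n 1) 1) p = p"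
    "fbilinear (map2 (*)) p (Poly_Mapping.single (replicate n 1) 1) = p"
    unfolding fbilinear_eq_lext free.lext_single free.scale_one
    by (subst free.lext_cong[where g = "\<lambda>xs. Poly_Mapping.single xs 1"]; simp add: one len id)+
  then show "tmult n (tone n) t = t" "tmult n t (tone n) = t"
    using p by (simp_all add: tone_def pure_def tmult_tclass formal_single)
qed

lemma tinverse:
  assumes "tinvertible n s"
  shows "s \<in> tensor_power n" "tinverse n s \<in> tensor_power n"
    and "tmult n s (tinverse n s) = tone n" "tmult n (tinverse n s) s = tone n"
proof -
  show s: "s \<in> tensor_power n"
    using assms by (simp add: tinvertible_def)
  obtain t where t: "t \<in> tensor_power n" "tmult n s t = tone n" "tmult n t s = tone n"
    using assms by (auto simp: tinvertible_def)
  have "tinverse n s = t"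
    unfolding tinverse_def
  proof (rule the_equality)
    fix t' assume t': "t' \<in> tensor_power n \<and> tmult n s t' = tone n \<and> tmult n t' s = tone n"
    then have "tmult n (tmult n t' s) t = tmult n t' (tmult n s t)"
      using s t by (intro tmult_assoc) simp_all
    then show "t' = t"
      using t t' by (simp add: tmult_tone)
  qed (use t in simp)
  then show "tinverse n s \<in> tensor_power n"
    "tmult n s (tinverse n s) = tone n" "tmult n (tinverse n s) s = tone n"
    using t by simp_all
qed

section \<open>Multilinear functions of two, three and four arguments\<close>

definition bilin :: "('a \<Rightarrow> 'a \<Rightarrow> 'a) \<Rightarrow> bool"
  where "bilin f \<longleftrightarrow> (\<forall>y. lin (\<lambda>x. f x y)) \<and> (\<forall>x. lin (f x))"

definition trilin :: "('a \<Rightarrow> 'a \<Rightarrow> 'a \<Rightarrow> 'a) \<Rightarrow> bool"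
  where "trilin f \<longleftrightarrow> (\<forall>y z. lin (\<lambda>x. f x y z)) \<and> (\<forall>x. bilin (f x))"

definition quadlin :: "('a \<Rightarrow> 'a \<Rightarrow> 'a \<Rightarrow> 'a \<Rightarrow> 'a) \<Rightarrow> bool"
  where "quadlin f \<longleftrightarrow> (\<forall>y z w. lin (\<lambda>x. f x y z w)) \<and> (\<forall>x. trilin (f x))"

lemma multilinear_2:
  assumes "bilin f"
  shows "multilinear 2 (\<lambda>xs. f (xs ! 0) (xs ! 1))"
  unfolding multilinear_def
proof (intro allI impI)
  fix xs ys :: "'a list" assume len: "length xs + 1 + length ys = 2"
  then consider "length xs = 0" | "length xs = 1"
    by linarith
  then show "lin (\<lambda>a. f ((xs @ a # ys) ! 0) ((xs @ a # ys) ! 1))"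
    by cases (use len assms in \<open>simp_all add: nth_append bilin_def\<close>)
qed

lemma multilinear_3:
  assumes "trilin f"
  shows "multilinear 3 (\<lambda>xs. f (xs ! 0) (xs ! 1) (xs ! 2))"
  unfolding multilinear_def
proof (intro allI impI)
  fix xs ys :: "'a list" assume len: "length xs + 1 + length ys = 3"
  then consider "length xs = 0" | "length xs = 1" | "length xs = 2"
    by linarith
  then show "lin (\<lambda>a. f ((xs @ a # ys) ! 0) ((xs @ a # ys) ! 1) ((xs @ a # ys) ! 2))"
    by cases (use len assms in \<open>simp_all add: nth_append bilin_def trilin_def\<close>)
qed

lemma multilinear_4:
  assumes "quadlin f"
  shows "multilinear 4 (\<lambda>xs. f (xs ! 0) (xs ! 1) (xs ! 2) (xs ! 3))"
  unfolding multilinear_def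
proof (intro allI impI)
  fix xs ys :: "'a list" assume len: "length xs + 1 + length ys = 4"
  then consider "length xs = 0" | "length xs = 1" | "length xs = 2" | "length xs = 3"
    by linarith
  then show "lin (\<lambda>a. f ((xs @ a # ys) ! 0) ((xs @ a # ys) ! 1) ((xs @ a # ys) ! 2)
      ((xs @ a # ys) ! 3))"
    by cases (use len assms in \<open>simp_all add: nth_append bilin_def trilin_def quadlin_def\<close>)
qed

lemma tmultilinear_2:
  assumes "\<And>y. tlin m (\<lambda>x. F x y)" "\<And>x. tlin m (F x)"
  shows "tmultilinear 2 m (\<lambda>xs. F (xs ! 0) (xs ! 1))"
  unfolding tmultilinear_def
proof (intro conjI allI impI)
  fix xs ys :: "'a list" assume len: "length xs + 1 + length ys = 2"
  then consider "length xs = 0" | "length xs = 1"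
    by linarith
  then show "tlin m (\<lambda>a. F ((xs @ a # ys) ! 0) ((xs @ a # ys) ! 1))"
    by cases (use len assms in \<open>simp_all add: nth_append\<close>)
qed (use assms in \<open>simp add: tlin_def\<close>)

lemma tmultilinear_3:
  assumes "\<And>y z. tlin m (\<lambda>x. F x y z)" "\<And>x z. tlin m (\<lambda>y. F x y z)" "\<And>x y. tlin m (F x y)"
  shows "tmultilinear 3 m (\<lambda>xs. F (xs ! 0) (xs ! 1) (xs ! 2))"
  unfolding tmultilinear_def
proof (intro conjI allI impI)
  fix xs ys :: "'a list" assume len: "length xs + 1 + length ys = 3"
  then consider "length xs = 0" | "length xs = 1" | "length xs = 2"
    by linarith
  then show "tlin m (\<lambda>a. F ((xs @ a # ys) ! 0) ((xs @ a # ys) ! 1) ((xs @ a # ys) ! 2))"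
    by cases (use len assms in \<open>simp_all add: nth_append\<close>)
qed (use assms in \<open>simp add: tlin_def\<close>)

lemma lin_mult_left: "lin f \<Longrightarrow> lin (\<lambda>a. c * f a)"
  by (rule linI) (simp_all add: lin_add lin_scale distrib_left scale_mult_right)

lemma lin_mult_right: "lin f \<Longrightarrow> lin (\<lambda>a. f a * c)"
  by (rule linI) (simp_all add: lin_add lin_scale distrib_right scale_mult_left)

lemma lin_scaled: "lin f \<Longrightarrow> lin (\<lambda>a. c *s f a)"
  by (rule linI) (simp_all add: lin_add lin_scale scale_right_distrib mult.commute)

lemma lin_ev:
  assumes "\<And>xs. lin (\<lambda>a. f a xs)"
  shows "lin (\<lambda>a. ev t (f a))"
proof -
  have "f (a + b) = (\<lambda>xs. f a xs + f b xs)" "f (c *s a) = (\<lambda>xs. c *s f a xs)" for a b c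
    using lin_add[OF assms] lin_scale[OF assms] by auto
  then show ?thesis
    by (intro linI) (simp_all only: ev_add ev_scale)
qed

lemma lin_comp: "lin g \<Longrightarrow> lin f \<Longrightarrow> lin (\<lambda>a. g (f a))"
  by (rule linI) (simp_all add: lin_add lin_scale)

lemma bilinI: "(\<And>y. lin (\<lambda>x. f x y)) \<Longrightarrow> (\<And>x. lin (\<lambda>y. f x y)) \<Longrightarrow> bilin f"
  by (simp add: bilin_def)

lemma trilinI:
  "(\<And>y z. lin (\<lambda>x. f x y z)) \<Longrightarrow> (\<And>x z. lin (\<lambda>y. f x y z)) \<Longrightarrow> (\<And>x y. lin (\<lambda>z. f x y z)) \<Longrightarrow>
    trilin f"
  by (simp add: trilin_def bilin_def)

lemma quadlinI:
  "(\<And>y z w. lin (\<lambda>x. f x y z w)) \<Longrightarrow> (\<And>x z w. lin (\<lambda>y. f x y z w)) \<Longrightarrow>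
    (\<And>x y w. lin (\<lambda>z. f x y z w)) \<Longrightarrow> (\<And>x y z. lin (\<lambda>w. f x y z w)) \<Longrightarrow> quadlin f"
  by (simp add: quadlin_def trilin_def bilin_def)

text \<open>Composition with a linear \<open>g\<close> is built in: used backwards, the rule strips
  off \<open>f\<close> and leaves the linearity of what stands in one slot.\<close>

lemma bilinD:
  assumes "bilin f" "lin g"
  shows "lin (\<lambda>a. f (g a) y)" "lin (\<lambda>a. f x (g a))"
  using assms lin_comp[of "\<lambda>x. f x y" g] lin_comp[of "f x" g] by (simp_all add: bilin_def)

lemma trilinD:
  assumes "trilin f" "lin g"
  shows "lin (\<lambda>a. f (g a) y z)" "lin (\<lambda>a. f x (g a) z)" "lin (\<lambda>a. f x y (g a))"
  using assms lin_comp[of "\<lambda>x. f x y z" g] bilinD[of "f x"] by (simp_all add: trilin_def)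

lemma quadlinD:
  assumes "quadlin f" "lin g"
  shows "lin (\<lambda>a. f (g a) y z w)" "lin (\<lambda>a. f x (g a) z w)"
    "lin (\<lambda>a. f x y (g a) w)" "lin (\<lambda>a. f x y z (g a))"
  using assms lin_comp[of "\<lambda>x. f x y z w" g] trilinD[of "f x"] by (simp_all add: quadlin_def)

lemmas lin_intros = lin_id lin_mult_left lin_mult_right lin_scaled lin_ev bilinI trilinI quadlinI

abbreviation "ev4 t f \<equiv> ev t (\<lambda>xs. f (xs ! 0) (xs ! 1) (xs ! 2) (xs ! 3))"

lemma ev2_tmult:
  assumes "s \<in> tensor_power 2" "t \<in> tensor_power 2" "bilin f"
  shows "ev2 (tmult 2 s t) f = ev2 s (\<lambda>a b. ev2 t (\<lambda>a' b'. f (a * a') (b * b')))"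
  unfolding ev_tmult[OF assms(1,2) multilinear_2[OF assms(3)]]
  by (intro ev_cong[OF assms(1)] ev_cong[OF assms(2)]) simp

lemma ev3_tmult:
  assumes "s \<in> tensor_power 3" "t \<in> tensor_power 3" "trilin f"
  shows "ev3 (tmult 3 s t) f =
    ev3 s (\<lambda>a b c. ev3 t (\<lambda>a' b' c'. f (a * a') (b * b') (c * c')))"
  unfolding ev_tmult[OF assms(1,2) multilinear_3[OF assms(3)]]
  by (intro ev_cong[OF assms(1)] ev_cong[OF assms(2)]) simp

lemma ev4_tmult:
  assumes "s \<in> tensor_power 4" "t \<in> tensor_power 4" "quadlin f"
  shows "ev4 (tmult 4 s t) f =
    ev4 s (\<lambda>a b c d. ev4 t (\<lambda>a' b' c' d'. f (a * a') (b * b') (c * c') (d * d')))"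
  unfolding ev_tmult[OF assms(1,2) multilinear_4[OF assms(3)]]
  by (intro ev_cong[OF assms(1)] ev_cong[OF assms(2)]) simp

lemma ev2_pure: "bilin f \<Longrightarrow> ev2 (pure [a, b]) f = f a b"
  using ev_pure[of "[a, b]"] multilinear_2[of f] by (simp add: numeral_2_eq_2)

lemma ev2_tone: "bilin f \<Longrightarrow> ev2 (tone 2) f = f 1 1"
  using ev_pure[of "replicate 2 1"] multilinear_2[of f] by (simp add: tone_def)

lemma ev3_tone: "trilin f \<Longrightarrow> ev3 (tone 3) f = f 1 1 1"
  using ev_pure[of "replicate 3 1"] multilinear_3[of f] by (simp add: tone_def)

lemma ev_touter_pure_left:
  assumes "t \<in> tensor_power n" "length us = m" "multilinear (m + n) f"
  shows "ev (touter m n (pure us) t) f = ev t (\<lambda>ys. f (us @ ys))"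
proof -
  have "multilinear m (\<lambda>xs. ev t (\<lambda>ys. f (xs @ ys)))"
    using multilinear_slotwise_linear[OF slotwise_linear_append(1) assms(3)]
    by (rule multilinear_ev[OF assms(1)])
  then show ?thesis
    using assms by (simp add: ev_touter pure_closed ev_pure)
qed

lemma ev_touter_pure_right:
  assumes "t \<in> tensor_power m" "length us = n" "multilinear (m + n) f"
  shows "ev (touter m n t (pure us)) f = ev t (\<lambda>xs. f (xs @ us))"
proof -
  have "ev (touter m n t (pure us)) f = ev t (\<lambda>xs. ev (pure us) (\<lambda>ys. f (xs @ ys)))"
    using assms by (simp add: ev_touter pure_closed)
  also have "\<dots> = ev t (\<lambda>xs. f (xs @ us))"
  proof (rule ev_cong[OF assms(1)])
    fix xs :: "'a list" assume "length xs = m"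
    from multilinear_slotwise_linear[OF slotwise_linear_append(2)[OF this] assms(3)]
    show "ev (pure us) (\<lambda>ys. f (xs @ ys)) = f (xs @ us)"
      by (simp add: ev_pure assms(2))
  qed
  finally show ?thesis .
qed

end


section \<open>The axioms in terms of multilinear functions\<close>

declare One_nat_def [simp del]

context quasi_bialgebra
begin

lemma \<Phi>_closed: "\<Phi> \<in> tensor_power 3"
  and \<Phi>inv_closed: "\<Phi>inv \<in> tensor_power 3"
  and \<Phi>_\<Phi>inv: "tmult 3 \<Phi> \<Phi>inv = tone 3"
  and \<Phi>inv_\<Phi>: "tmult 3 \<Phi>inv \<Phi> = tone 3"
  using tinverse[OF \<Phi>_invertible] by (simp_all add: \<Phi>inv_def)

lemma tlin_\<Delta>: "tlin 2 \<Delta>"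
  by (simp add: tlin_def \<Delta>_closed \<Delta>_add \<Delta>_scale)

lemma lin_ev_\<Delta>:
  assumes "lin f" "bilin g"
  shows "lin (\<lambda>a. ev2 (\<Delta> (f a)) g)"
  using lin_comp[OF lin_ev_tlin[OF multilinear_2[OF assms(2)] tlin_\<Delta>] assms(1)] .

lemma lin_\<epsilon>:
  assumes "lin f"
  shows "lin (\<lambda>a. \<epsilon> (f a) *s c)"
proof -
  interpret \<epsilon>: Vector_Spaces.linear scale "(*)" \<epsilon>
    by (rule \<epsilon>_linear)
  show ?thesis
    by (rule linI) (simp_all add: lin_add[OF assms] lin_scale[OF assms] \<epsilon>.add \<epsilon>.scale
        scale_left_distrib)
qed

lemmas lin_bialgebra_intros = lin_intros lin_ev_\<Delta> lin_\<epsilon>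

lemma tlin_pure_rules:
  "tlin 1 (\<lambda>a. pure [a])" "tlin 2 (\<lambda>a. pure [a, b])" "tlin 2 (\<lambda>a. pure [b, a])"
  using tlin_pure[of "[]" "[]"] tlin_pure[of "[]" "[b]"] tlin_pure[of "[b]" "[]"] by simp_all

lemma pure_closed_rules:
  "pure [a] \<in> tensor_power 1" "pure [a, b] \<in> tensor_power 2"
  by (simp_all add: pure_closed)

lemma \<Phi>_\<Phi>inv_ev:
  assumes "trilin f"
  shows "ev3 \<Phi> (\<lambda>x y z. ev3 \<Phi>inv (\<lambda>x' y' z'. f (x * x') (y * y') (z * z'))) = f 1 1 1"
  using ev3_tmult[OF \<Phi>_closed \<Phi>inv_closed assms] by (simp add: \<Phi>_\<Phi>inv ev3_tone assms)

text \<open>The linear \<open>f\<close> stands for the surrounding expression, so that the counit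
  axiom applies inside a larger sum.\<close>

lemma counit_left_ev:
  assumes "lin f"
  shows "ev2 (\<Delta> a) (\<lambda>x y. \<epsilon> x *s f y) = f a"
proof -
  have "bilin (\<lambda>x y. \<epsilon> x *s y)"
    by (intro lin_bialgebra_intros)
  from sum_alg_eq_ev[OF \<Delta>_closed multilinear_2[OF this], of a]
  have "f (ev2 (\<Delta> a) (\<lambda>x y. \<epsilon> x *s y)) = f a"
    by (simp add: counit_left)
  then show ?thesis
    by (simp add: ev_lin[OF assms, symmetric] lin_scale[OF assms])
qed

lemma counit_right_ev:
  assumes "lin f"
  shows "ev2 (\<Delta> a) (\<lambda>x y. \<epsilon> y *s f x) = f a"
proof -
  have "bilin (\<lambda>x y. \<epsilon> y *s x)"
    by (intro lin_bialgebra_intros)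
  from sum_alg_eq_ev[OF \<Delta>_closed multilinear_2[OF this], of a]
  have "f (ev2 (\<Delta> a) (\<lambda>x y. \<epsilon> y *s x)) = f a"
    by (simp add: counit_right)
  then show ?thesis
    by (simp add: ev_lin[OF assms, symmetric] lin_scale[OF assms])
qed

lemma counit_\<Phi>_middle:
  assumes "bilin f"
  shows "ev3 \<Phi> (\<lambda>x y z. \<epsilon> y *s f x z) = f 1 1"
proof -
  have "tmultilinear 3 2 (\<lambda>xs. tscale 2 (\<epsilon> (xs ! 1)) (pure [xs ! 0, xs ! 2]))"
    by (rule tmultilinear_3)
      (intro tlin_tscale tlin_tscale_scalar tlin_pure_rules pure_closed_rules \<epsilon>_linear)+
  from sum_ten_closed_ev(2)[OF \<Phi>_closed this multilinear_2[OF assms]]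
  have "f 1 1 = ev \<Phi> (\<lambda>xs. ev2 (tscale 2 (\<epsilon> (xs ! 1)) (pure [xs ! 0, xs ! 2])) f)"
    by (simp add: counit_\<Phi> ev2_tone assms)
  then show ?thesis
    by (simp add: ev_tscale[OF multilinear_2[OF assms] pure_closed_rules(2)] ev2_pure[OF assms])
qed

lemma ev3_touter_right:
  assumes "trilin g"
  shows "ev3 (touter 2 1 (\<Delta> x) (pure [y])) g = ev2 (\<Delta> x) (\<lambda>a b. g a b y)"
proof -
  have "ev3 (touter 2 1 (\<Delta> x) (pure [y])) g =
      ev (\<Delta> x) (\<lambda>xs. g ((xs @ [y]) ! 0) ((xs @ [y]) ! 1) ((xs @ [y]) ! 2))"
    using ev_touter_pure_right[OF \<Delta>_closed[of x], of "[y]" 1] multilinear_3[OF assms] by simp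
  also have "\<dots> = ev2 (\<Delta> x) (\<lambda>a b. g a b y)"
    by (rule ev_cong[OF \<Delta>_closed]) (simp add: nth_append)
  finally show ?thesis .
qed

lemma quasi_coassociative_ev:
  assumes "trilin f"
  shows "ev2 (\<Delta> a) (\<lambda>x y. ev2 (\<Delta> y) (\<lambda>y1 y2. ev3 \<Phi> (\<lambda>X Y Z. f (x * X) (y1 * Y) (y2 * Z)))) =
    ev3 \<Phi> (\<lambda>X Y Z. ev2 (\<Delta> a) (\<lambda>x y. ev2 (\<Delta> x) (\<lambda>x1 x2. f (X * x1) (Y * x2) (Z * y))))"
proof -
  let ?L = "\<lambda>xs. touter 1 2 (pure [xs ! 0]) (\<Delta> (xs ! 1))"
  let ?R = "\<lambda>xs. touter 2 1 (\<Delta> (xs ! 0)) (pure [xs ! 1])"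
  have L: "tmultilinear 2 3 ?L"
    by (rule tmultilinear_2)
      (intro tlin_touter_left tlin_touter_right tlin_pure_rules tlin_\<Delta> pure_closed_rules \<Delta>_closed,
        simp)+
  have R: "tmultilinear 2 3 ?R"
    by (rule tmultilinear_2)
      (intro tlin_touter_left tlin_touter_right tlin_pure_rules tlin_\<Delta> pure_closed_rules \<Delta>_closed,
        simp)+
  note LR = sum_ten_closed_ev[OF \<Delta>_closed L] sum_ten_closed_ev[OF \<Delta>_closed R]
  have evL: "ev3 (touter 1 2 (pure [x]) (\<Delta> y)) g = ev2 (\<Delta> y) (g x)" if "trilin g" for x y g
    using ev_touter_pure_left[OF \<Delta>_closed[of y], of "[x]" 1, simplified, OF multilinear_3[OF that]]
    by (simp add: One_nat_def numeral_2_eq_2)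
  note f = trilinD[OF assms]
  \<comment> \<open>The factor \<Phi> is absorbed into the function, here as a right factor and
    below as a left one with its components fixed, before the coproduct sums are evaluated.\<close>
  have 1: "trilin (\<lambda>x y z. ev3 \<Phi> (\<lambda>X Y Z. f (x * X) (y * Y) (z * Z)))"
    by (intro lin_bialgebra_intros f)
  have 2: "trilin (\<lambda>x y z. f (X * x) (Y * y) (Z * z))" for X Y Z
    by (intro lin_bialgebra_intros f)
  show ?thesis
    using arg_cong[OF quasi_coassociative[of a], of "\<lambda>t. ev3 t f"]
    by (simp add: ev3_tmult[OF _ _ assms] \<Phi>_closed LR(1,3) LR(2)[OF multilinear_3[OF 1]]
        LR(4)[OF multilinear_3[OF 2]] evL[OF 1] ev3_touter_right[OF 2])
qed

lemma \<Phi>inv_\<Phi>_ev: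
  assumes "trilin f"
  shows "ev3 \<Phi>inv (\<lambda>x y z. ev3 \<Phi> (\<lambda>x' y' z'. f (x * x') (y * y') (z * z'))) = f 1 1 1"
  using ev3_tmult[OF \<Phi>inv_closed \<Phi>_closed assms] by (simp add: \<Phi>inv_\<Phi> ev3_tone assms)

lemma pentagon_ev:
  assumes "quadlin f"
  shows "ev3 \<Phi> (\<lambda>X Y Z. ev2 (\<Delta> Z) (\<lambda>Z1 Z2. ev3 \<Phi> (\<lambda>X' Y' Z'. ev2 (\<Delta> X') (\<lambda>X1 X2.
      f (X * X1) (Y * X2) (Z1 * Y') (Z2 * Z'))))) =
    ev3 \<Phi> (\<lambda>A B C. ev3 \<Phi> (\<lambda>X Y Z. ev2 (\<Delta> Y) (\<lambda>Y1 Y2. ev3 \<Phi> (\<lambda>P Q T.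
      f (X * P) (A * Y1 * Q) (B * Y2 * T) (C * Z)))))"
proof -
  let ?L = "\<lambda>xs. touter 2 2 (pure [xs ! 0, xs ! 1]) (\<Delta> (xs ! 2))"
  let ?R = "\<lambda>xs. touter 2 2 (\<Delta> (xs ! 0)) (pure [xs ! 1, xs ! 2])"
  let ?M = "\<lambda>xs. touter 1 3 (pure [xs ! 0]) (touter 2 1 (\<Delta> (xs ! 1)) (pure [xs ! 2]))"
  have L: "tmultilinear 3 4 ?L"
    by (rule tmultilinear_3)
      (intro tlin_touter_left tlin_touter_right tlin_pure_rules tlin_\<Delta> pure_closed_rules \<Delta>_closed,
        simp)+
  have R: "tmultilinear 3 4 ?R"
    by (rule tmultilinear_3)
      (intro tlin_touter_left tlin_touter_right tlin_pure_rules tlin_\<Delta> pure_closed_rules \<Delta>_closed,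
        simp)+
  have c: "touter 2 1 (\<Delta> y) (pure [z]) \<in> tensor_power 3" for y z
    by (rule touter_closed[OF \<Delta>_closed pure_closed_rules(1)]) simp
  have M: "tmultilinear 3 4 ?M"
    by (rule tmultilinear_3)
      (intro tlin_touter_left[of 1 _ _ 3] tlin_touter_right[of 3 _ _ 1] tlin_touter_left[of 2 _ _ 1]
        tlin_touter_right[of 1 _ _ 2] tlin_pure_rules tlin_\<Delta> pure_closed_rules \<Delta>_closed c; simp)+
  note LR = sum_ten_closed_ev[OF \<Phi>_closed L] sum_ten_closed_ev[OF \<Phi>_closed R]
    sum_ten_closed_ev[OF \<Phi>_closed M]
  have c1: "touter 1 3 (pure [1]) \<Phi> \<in> tensor_power 4" "touter 3 1 \<Phi> (pure [1]) \<in> tensor_power 4"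
    by (rule touter_closed[OF pure_closed_rules(1) \<Phi>_closed]
        touter_closed[OF \<Phi>_closed pure_closed_rules(1)], simp)+
  have evL: "ev4 (touter 2 2 (pure [x, y]) (\<Delta> z)) g = ev2 (\<Delta> z) (g x y)" if "quadlin g" for x y z g
    using ev_touter_pure_left[OF \<Delta>_closed[of z], of "[x, y]" 2, simplified, OF multilinear_4[OF that]]
    by (simp add: One_nat_def numeral_2_eq_2 numeral_3_eq_3)
  have evR: "ev4 (touter 2 2 (\<Delta> x) (pure [y, z])) g = ev2 (\<Delta> x) (\<lambda>a b. g a b y z)"
    if "quadlin g" for x y z g
  proof -
    have "ev4 (touter 2 2 (\<Delta> x) (pure [y, z])) g = ev (\<Delta> x) (\<lambda>xs. g ((xs @ [y, z]) ! 0)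
        ((xs @ [y, z]) ! 1) ((xs @ [y, z]) ! 2) ((xs @ [y, z]) ! 3))"
      using ev_touter_pure_right[OF \<Delta>_closed[of x], of "[y, z]" 2] multilinear_4[OF that] by simp
    also have "\<dots> = ev2 (\<Delta> x) (\<lambda>a b. g a b y z)"
      by (rule ev_cong[OF \<Delta>_closed]) (simp add: nth_append)
    finally show ?thesis .
  qed
  have ev1: "ev4 (touter 1 3 (pure [x]) t) g = ev3 t (g x)"
    if "quadlin g" "t \<in> tensor_power 3" for x g t
    using ev_touter_pure_left[OF that(2), of "[x]" 1, simplified, OF multilinear_4[OF that(1)]]
    by (simp add: One_nat_def numeral_2_eq_2 numeral_3_eq_3)
  have ev3: "ev4 (touter 3 1 \<Phi> (pure [x])) g = ev3 \<Phi> (\<lambda>a b c. g a b c x)"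
    if "quadlin g" for x g
  proof -
    have "ev4 (touter 3 1 \<Phi> (pure [x])) g = ev \<Phi> (\<lambda>xs. g ((xs @ [x]) ! 0)
        ((xs @ [x]) ! 1) ((xs @ [x]) ! 2) ((xs @ [x]) ! 3))"
      using ev_touter_pure_right[OF \<Phi>_closed, of "[x]" 1] multilinear_4[OF that] by simp
    also have "\<dots> = ev3 \<Phi> (\<lambda>a b c. g a b c x)"
      by (rule ev_cong[OF \<Phi>_closed]) (simp add: nth_append)
    finally show ?thesis .
  qed
  have evM: "ev4 (touter 1 3 (pure [x]) (touter 2 1 (\<Delta> y) (pure [z]))) g =
      ev2 (\<Delta> y) (\<lambda>a b. g x a b z)" if "quadlin g" for x y z g
    using ev1[OF that c] ev3_touter_right[of "g x"] that by (simp add: quadlin_def)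
  note f = quadlinD[OF assms]
  \<comment> \<open>\<open>f\<close> with the rightmost factor of each side absorbed:
    \<open>(\<Delta> \<otimes> id \<otimes> id)(\<Phi>)\<close> for the left side,
    \<open>\<Phi> \<otimes> 1\<close> for the right side.\<close>
  let ?f\<Delta> = "\<lambda>a b c d. ev3 \<Phi> (\<lambda>X' Y' Z'. ev2 (\<Delta> X') (\<lambda>X1 X2. f (a * X1) (b * X2) (c * Y') (d * Z')))"
  let ?f\<Phi> = "\<lambda>a b c d. ev3 \<Phi> (\<lambda>P Q T. f (a * P) (b * Q) (c * T) d)"
  have 1: "quadlin (\<lambda>a b c d. f (X * a) (Y * b) (Z * c) (W * d))" for X Y Z W
    by (intro lin_bialgebra_intros f)
  have 2: "quadlin ?f\<Delta>"
    by (intro lin_bialgebra_intros f)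
  have 3: "quadlin ?f\<Phi>"
    by (intro lin_bialgebra_intros f)
  have 4: "quadlin (\<lambda>a b c d. ?f\<Phi> (X * a) (Y * b) (Z * c) (W * d))" for X Y Z W
    by (intro lin_bialgebra_intros f)
  have 5: "quadlin (\<lambda>a b c d. ev3 \<Phi> (\<lambda>X Y Z. ev2 (\<Delta> Y) (\<lambda>Y1 Y2. ?f\<Phi> (a * X) (b * Y1) (c * Y2) (d * Z))))"
    by (intro lin_bialgebra_intros f)
  have "ev4 (tmult 4 (sum_ten 4 \<Phi> ?L) (sum_ten 4 \<Phi> ?R)) f =
      ev4 (sum_ten 4 \<Phi> ?L) (\<lambda>a b c d. ev4 (sum_ten 4 \<Phi> ?R) (\<lambda>a' b' c' d'.
        f (a * a') (b * b') (c * c') (d * d')))"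
    by (rule ev4_tmult[OF LR(1,3) assms])
  also have "\<dots> = ev4 (sum_ten 4 \<Phi> ?L) ?f\<Delta>"
    by (simp only: LR(4)[OF multilinear_4[OF 1]] evR[OF 1])
  also have "\<dots> = ev3 \<Phi> (\<lambda>X Y Z. ev2 (\<Delta> Z) (?f\<Delta> X Y))"
    by (simp only: LR(2)[OF multilinear_4[OF 2]] evL[OF 2])
  finally have lhs: "ev4 (tmult 4 (sum_ten 4 \<Phi> ?L) (sum_ten 4 \<Phi> ?R)) f = \<dots>" .
  have "ev4 (tmult 4 (tmult 4 (touter 1 3 (pure [1]) \<Phi>) (sum_ten 4 \<Phi> ?M))
        (touter 3 1 \<Phi> (pure [1]))) f =
      ev4 (tmult 4 (touter 1 3 (pure [1]) \<Phi>) (sum_ten 4 \<Phi> ?M)) ?f\<Phi>"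
    by (simp only: ev4_tmult[OF tmult_closed[OF c1(1) LR(5)] c1(2) assms] ev3[OF 1] mult_1_right)
  also have "\<dots> = ev4 (touter 1 3 (pure [1]) \<Phi>) (\<lambda>a b c d.
      ev3 \<Phi> (\<lambda>X Y Z. ev2 (\<Delta> Y) (\<lambda>Y1 Y2. ?f\<Phi> (a * X) (b * Y1) (c * Y2) (d * Z))))"
    by (simp only: ev4_tmult[OF c1(1) LR(5) 3] LR(6)[OF multilinear_4[OF 4]] evM[OF 4])
  also have "\<dots> = ev3 \<Phi> (\<lambda>A B C. ev3 \<Phi> (\<lambda>X Y Z. ev2 (\<Delta> Y) (\<lambda>Y1 Y2. ev3 \<Phi> (\<lambda>P Q T.
      f (X * P) (A * Y1 * Q) (B * Y2 * T) (C * Z)))))"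
    by (simp only: ev1[OF 5 \<Phi>_closed] mult_1_left)
  finally show ?thesis
    using lhs pentagon by simp
qed

section \<open>The counit on the outer legs of the reassociator\<close>

lemma ev2_\<Delta>_one: "bilin f \<Longrightarrow> ev2 (\<Delta> 1) f = f 1 1"
  by (simp add: \<Delta>_one ev2_tone)

lemma \<epsilon>_mult_scale: "\<epsilon> (a * b) *s x = \<epsilon> a *s \<epsilon> b *s x"
  by (simp add: \<epsilon>_mult)

text \<open>With \<epsilon> in the second slot, the left side of the pentagon becomes \<Phi> and the
  right side \<open>(1 \<otimes> (\<epsilon> \<otimes> id \<otimes> id)(\<Phi>)) \<Phi>\<close>.
  Cancelling \<Phi> on the right and applying \<epsilon> to the first slot gives the claim.\<close>

lemma counit_\<Phi>_left:
  assumes "bilin h"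
  shows "ev3 \<Phi> (\<lambda>x y z. \<epsilon> x *s h y z) = h 1 1"
proof -
  note h = bilinD[OF assms]
  \<comment> \<open>\<open>G\<close> evaluates \<epsilon> and \<open>h\<close> after right
    multiplication by \<open>\<Phi>inv\<close>, which carries out the cancellation.\<close>
  define G where "G x y z = ev3 \<Phi>inv (\<lambda>x' y' z'. \<epsilon> (x * x') *s h (y * y') (z * z'))" for x y z
  have "trilin G"
    unfolding G_def by (intro lin_bialgebra_intros h)
  note G = trilinD[OF this]
  have k: "trilin (\<lambda>x y z. \<epsilon> x *s h (b * y) (c * z))" for b c
    by (intro lin_bialgebra_intros h)
  have "quadlin (\<lambda>a b c d. \<epsilon> b *s G a c d)"
    by (intro lin_bialgebra_intros G)
  from pentagon_ev[OF this]
  have pent: "ev3 \<Phi> (\<lambda>X Y Z. ev2 (\<Delta> Z) (\<lambda>Z1 Z2. ev3 \<Phi> (\<lambda>X' Y' Z'. ev2 (\<Delta> X') (\<lambda>X1 X2.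
      \<epsilon> (Y * X2) *s G (X * X1) (Z1 * Y') (Z2 * Z'))))) =
    ev3 \<Phi> (\<lambda>A B C. ev3 \<Phi> (\<lambda>X Y Z. ev2 (\<Delta> Y) (\<lambda>Y1 Y2. ev3 \<Phi> (\<lambda>P Q T.
      \<epsilon> (A * Y1 * Q) *s G (X * P) (B * Y2 * T) (C * Z)))))"
    (is "?l = ?r") .
  have l1: "ev2 (\<Delta> X') (\<lambda>X1 X2. \<epsilon> X2 *s G (X * X1) y z) = G (X * X') y z" for X X' y z
    by (rule counit_right_ev) (intro lin_bialgebra_intros G)
  have l2: "bilin (\<lambda>Z1 Z2. ev3 \<Phi> (\<lambda>X' Y' Z'. G (X * X') (Z1 * Y') (Z2 * Z')))" for X
    by (intro lin_bialgebra_intros G)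
  have l3: "bilin (\<lambda>X Z. ev2 (\<Delta> Z) (\<lambda>Z1 Z2. ev3 \<Phi> (\<lambda>X' Y' Z'. G (X * X') (Z1 * Y') (Z2 * Z'))))"
    by (intro lin_bialgebra_intros G)
  have "?l = ev3 \<Phi> G"
    by (simp only: \<epsilon>_mult_scale ev_scale l1 counit_\<Phi>_middle[OF l3] ev2_\<Delta>_one[OF l2], simp only: mult_1_left)
  also have "ev3 \<Phi> G = h 1 1"
    unfolding G_def using \<Phi>_\<Phi>inv_ev[OF k[of 1 1]] by (simp add: \<epsilon>_one)
  finally have l: "?l = h 1 1" .
  have r1: "bilin (\<lambda>P T. G (X * P) (y * T) z)" for X y z
    by (intro lin_bialgebra_intros G)
  have r2: "ev2 (\<Delta> Y) (\<lambda>Y1 Y2. \<epsilon> Y1 *s G X (B * Y2) z) = G X (B * Y) z" for X Y B z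
    by (rule counit_left_ev) (intro lin_bialgebra_intros G)
  have "ev3 \<Phi> (\<lambda>X Y Z. G X (B * Y) (C * Z)) = h B C" for B C
    unfolding G_def using \<Phi>_\<Phi>inv_ev[OF k[of B C]] by (simp add: \<epsilon>_one mult.assoc)
  then have "?r = ev3 \<Phi> (\<lambda>A B C. \<epsilon> A *s h B C)"
    by (simp only: \<epsilon>_mult_scale ev_scale counit_\<Phi>_middle[OF r1] r2 mult_1_right)
  with l pent show ?thesis
    by simp
qed

text \<open>The mirror image, with \<epsilon> in the third slot of the pentagon. The unknown factor
  now stands to the right of \<Phi>, so \<open>\<Phi>inv\<close> multiplies from the left in
  \<open>G\<close>.\<close>

lemma counit_\<Phi>_right:
  assumes "bilin h"
  shows "ev3 \<Phi> (\<lambda>x y z. \<epsilon> z *s h x y) = h 1 1"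
proof -
  note h = bilinD[OF assms]
  define G where "G x y z = ev3 \<Phi>inv (\<lambda>x' y' z'. \<epsilon> (z' * z) *s h (x' * x) (y' * y))" for x y z
  have "trilin G"
    unfolding G_def by (intro lin_bialgebra_intros h)
  note G = trilinD[OF this]
  have k: "trilin (\<lambda>x y z. \<epsilon> z *s h (x * P) (y * Q))" for P Q
    by (intro lin_bialgebra_intros h)
  have "quadlin (\<lambda>a b c d. \<epsilon> c *s G a b d)"
    by (intro lin_bialgebra_intros G)
  from pentagon_ev[OF this]
  have pent: "ev3 \<Phi> (\<lambda>X Y Z. ev2 (\<Delta> Z) (\<lambda>Z1 Z2. ev3 \<Phi> (\<lambda>X' Y' Z'. ev2 (\<Delta> X') (\<lambda>X1 X2.
      \<epsilon> (Z1 * Y') *s G (X * X1) (Y * X2) (Z2 * Z'))))) =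
    ev3 \<Phi> (\<lambda>A B C. ev3 \<Phi> (\<lambda>X Y Z. ev2 (\<Delta> Y) (\<lambda>Y1 Y2. ev3 \<Phi> (\<lambda>P Q T.
      \<epsilon> (B * Y2 * T) *s G (X * P) (A * Y1 * Q) (C * Z)))))"
    (is "?l = ?r") .
  have l1: "bilin (\<lambda>X' Z'. ev2 (\<Delta> X') (\<lambda>X1 X2. G (X * X1) (Y * X2) (Z2 * Z')))" for X Y Z2
    by (intro lin_bialgebra_intros G)
  have l2: "bilin (\<lambda>X1 X2. G (X * X1) (Y * X2) z)" for X Y z
    by (intro lin_bialgebra_intros G)
  have l3: "ev2 (\<Delta> Z) (\<lambda>Z1 Z2. \<epsilon> Z1 *s G X Y Z2) = G X Y Z" for X Y Z
    by (rule counit_left_ev) (intro lin_bialgebra_intros G)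
  have "?l = ev3 \<Phi> G"
    by (simp only: \<epsilon>_mult_scale ev_scale counit_\<Phi>_middle[OF l1] ev2_\<Delta>_one[OF l2] l3 mult_1_right)
  also have "\<dots> = h 1 1"
    unfolding G_def using \<Phi>inv_\<Phi>_ev[OF k[of 1 1]] by (subst ev_swap) (simp add: \<epsilon>_one)
  finally have l: "?l = h 1 1" .
  have r1: "ev2 (\<Delta> Y) (\<lambda>Y1 Y2. \<epsilon> Y2 *s ev3 \<Phi> (\<lambda>P Q T. \<epsilon> T *s G (X * P) (A * Y1 * Q) z)) =
      ev3 \<Phi> (\<lambda>P Q T. \<epsilon> T *s G (X * P) (A * Y * Q) z)" for X Y A z
    by (rule counit_right_ev) (intro lin_bialgebra_intros G)
  have r2: "bilin (\<lambda>A C. ev3 \<Phi> (\<lambda>X Y Z. ev3 \<Phi> (\<lambda>P Q T. \<epsilon> T *s G (X * P) (A * Y * Q) (C * Z))))"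
    by (intro lin_bialgebra_intros G)
  have "?r = ev3 \<Phi> (\<lambda>X Y Z. ev3 \<Phi> (\<lambda>P Q T. \<epsilon> T *s G (X * P) (Y * Q) Z))"
    by (simp only: \<epsilon>_mult_scale ev_scale r1 counit_\<Phi>_middle[OF r2] mult_1_left)
  also have "\<dots> = ev3 \<Phi> (\<lambda>P Q T. \<epsilon> T *s ev3 \<Phi> (\<lambda>X Y Z. G (X * P) (Y * Q) Z))"
    by (subst ev_swap) (simp only: ev_scale)
  also have "\<dots> = ev3 \<Phi> (\<lambda>P Q T. \<epsilon> T *s h P Q)"
  proof -
    have "ev3 \<Phi> (\<lambda>X Y Z. G (X * P) (Y * Q) Z) = h P Q" for P Q
      unfolding G_def using \<Phi>inv_\<Phi>_ev[OF k[of P Q]]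
      by (subst ev_swap) (simp add: \<epsilon>_one mult.assoc)
    then show ?thesis
      by simp
  qed
  finally show ?thesis
    using l pent by simp
qed

end


section \<open>The Drinfel'd element\<close>

context quasi_hopf_algebra
begin

lemma S_lin: "lin f \<Longrightarrow> lin (\<lambda>a. S (f a))"
  using lin_comp[OF S_linear] .

abbreviation Si :: "'a \<Rightarrow> 'a"
  where "Si \<equiv> inv S"

lemma S_Si [simp]: "S (Si a) = a" and Si_S [simp]: "Si (S a) = a"
  using S_bij by (simp_all add: bij_is_surj surj_f_inv_f bij_is_inj)

lemma Si_eqI: "S b = a \<Longrightarrow> Si a = b"
  by auto

lemma Si_mult: "Si (a * b) = Si b * Si a"
  by (rule Si_eqI) (simp add: S_mult)

lemma Si_one: "Si 1 = 1"
  by (rule Si_eqI) (simp add: S_one)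

lemma lin_Si: "lin Si"
  by (intro linI Si_eqI) (simp_all add: lin_add[OF S_linear] lin_scale[OF S_linear])

lemma Si_lin: "lin f \<Longrightarrow> lin (\<lambda>a. Si (f a))"
  using lin_comp[OF lin_Si] .

lemmas lin_hopf_intros = lin_bialgebra_intros S_lin Si_lin

lemma antipode_\<alpha>_ev: "ev2 (\<Delta> a) (\<lambda>x y. S x * \<alpha> * y) = \<epsilon> a *s \<alpha>"
proof -
  have "bilin (\<lambda>x y. S x * \<alpha> * y)"
    by (intro lin_hopf_intros)
  from sum_alg_eq_ev[OF \<Delta>_closed multilinear_2[OF this]] show ?thesis
    using antipode_\<alpha>[of a] by simp
qed

lemma antipode_\<beta>_ev: "ev2 (\<Delta> a) (\<lambda>x y. x * \<beta> * S y) = \<epsilon> a *s \<beta>"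
proof -
  have "bilin (\<lambda>x y. x * \<beta> * S y)"
    by (intro lin_hopf_intros)
  from sum_alg_eq_ev[OF \<Delta>_closed multilinear_2[OF this]] show ?thesis
    using antipode_\<beta>[of a] by simp
qed

lemma antipode_\<Phi>_ev: "ev3 \<Phi> (\<lambda>x y z. x * \<beta> * S y * \<alpha> * z) = 1"
proof -
  have "trilin (\<lambda>x y z. x * \<beta> * S y * \<alpha> * z)"
    by (intro lin_hopf_intros)
  from sum_alg_eq_ev[OF \<Phi>_closed multilinear_3[OF this]] show ?thesis
    using antipode_\<Phi> by simp
qed

lemma antipode_\<Phi>inv_ev: "ev3 \<Phi>inv (\<lambda>x y z. S x * \<alpha> * y * \<beta> * S z) = 1"
proof -
  have "trilin (\<lambda>x y z. S x * \<alpha> * y * \<beta> * S z)"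
    by (intro lin_hopf_intros)
  from sum_alg_eq_ev[OF \<Phi>inv_closed multilinear_3[OF this]] show ?thesis
    using antipode_\<Phi>inv by simp
qed

text \<open>Applying the anti-automorphism \<open>Si\<close> reverses the products, so the antipode
  axiom becomes that of the coopposite algebra for \<open>Si\<close> and
  \<open>Si \<alpha>\<close>.\<close>

lemma antipode_cop_\<alpha>: "ev2 (\<Delta> a) (\<lambda>x y. Si y * Si \<alpha> * x) = \<epsilon> a *s Si \<alpha>"
  using arg_cong[OF antipode_\<alpha>_ev[of a], of Si]
  by (simp add: ev_lin[OF lin_Si, symmetric] lin_scale[OF lin_Si] Si_mult mult.assoc)

lemma antipode_cop_\<beta>: "ev2 (\<Delta> a) (\<lambda>x y. y * Si \<beta> * Si x) = \<epsilon> a *s Si \<beta>"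
  using arg_cong[OF antipode_\<beta>_ev[of a], of Si]
  by (simp add: ev_lin[OF lin_Si, symmetric] lin_scale[OF lin_Si] Si_mult mult.assoc)

text \<open>Drinfel'd's comparison element for the pairs S, \<gamma> and \<open>Si\<close>,
  \<open>Si \<alpha>\<close> on the coopposite algebra, whose inverse reassociator is \<Phi> with
  its three legs in reverse order.\<close>

definition intertwiner :: "'a \<Rightarrow> 'a"
  where "intertwiner \<gamma> = ev3 \<Phi> (\<lambda>X Y Z. S Z * \<gamma> * Y * Si \<beta> * Si X)"

section \<open>Properties of the comparison element\<close>

context
  fixes \<gamma> :: 'a
  assumes cop_antipode: "\<And>a. ev2 (\<Delta> a) (\<lambda>x y. S y * \<gamma> * x) = \<epsilon> a *s \<gamma>"
begin

text \<open>\<open>?G\<close> turns a coproduct multiplied from the left onto its last two slots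
  into a counit, through \<gamma>, and likewise one multiplied from the right onto its first two
  slots, through \<open>Si \<beta>\<close>. Of quasi-coassociativity only \<open>Si a\<close> on one
  side and \<open>S a\<close> on the other survive.\<close>

lemma S_intertwiner: "S a * intertwiner \<gamma> = intertwiner \<gamma> * Si a"
proof -
  let ?G = "\<lambda>x y z. S z * \<gamma> * y * Si \<beta> * Si x"
  have G: "trilin ?G"
    by (intro lin_hopf_intros)
  have l1: "ev2 (\<Delta> y) (\<lambda>y1 y2. ?G (x * X) (y1 * Y) (y2 * Z)) = \<epsilon> y *s (?G X Y Z * Si x)"
    for x y X Y Z
  proof -
    have "ev2 (\<Delta> y) (\<lambda>y1 y2. ?G (x * X) (y1 * Y) (y2 * Z)) =
        ev2 (\<Delta> y) (\<lambda>y1 y2. S Z * (S y2 * \<gamma> * y1) * (Y * Si \<beta> * Si X * Si x))"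
      by (simp add: S_mult Si_mult mult.assoc)
    also have "\<dots> = \<epsilon> y *s (?G X Y Z * Si x)"
      by (simp only: ev_mult_left ev_mult_right cop_antipode scale_mult_left scale_mult_right)
        (simp add: mult.assoc)
    finally show ?thesis .
  qed
  have l2: "ev2 (\<Delta> a) (\<lambda>x y. \<epsilon> y *s (c * Si x)) = c * Si a" for c
    by (rule counit_right_ev) (intro lin_hopf_intros)
  have l: "ev2 (\<Delta> a) (\<lambda>x y. ev2 (\<Delta> y) (\<lambda>y1 y2. ev3 \<Phi> (\<lambda>X Y Z. ?G (x * X) (y1 * Y) (y2 * Z)))) =
      intertwiner \<gamma> * Si a"
    unfolding intertwiner_def
    by (subst ev_swap, simp only: l1 ev_scale, simp only: ev_mult_right l2)
  have r1: "ev2 (\<Delta> x) (\<lambda>x1 x2. ?G (X * x1) (Y * x2) (Z * y)) = \<epsilon> x *s (S y * ?G X Y Z)"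
    for x y X Y Z
  proof -
    have "ev2 (\<Delta> x) (\<lambda>x1 x2. ?G (X * x1) (Y * x2) (Z * y)) =
        ev2 (\<Delta> x) (\<lambda>x1 x2. (S y * S Z * \<gamma> * Y) * (x2 * Si \<beta> * Si x1) * Si X)"
      by (simp add: S_mult Si_mult mult.assoc)
    also have "\<dots> = \<epsilon> x *s (S y * ?G X Y Z)"
      by (simp only: ev_mult_left ev_mult_right antipode_cop_\<beta> scale_mult_left scale_mult_right)
        (simp add: mult.assoc)
    finally show ?thesis .
  qed
  have r2: "ev2 (\<Delta> a) (\<lambda>x y. \<epsilon> x *s (S y * c)) = S a * c" for c
    by (rule counit_left_ev) (intro lin_hopf_intros)
  have "ev3 \<Phi> (\<lambda>X Y Z. ev2 (\<Delta> a) (\<lambda>x y. ev2 (\<Delta> x) (\<lambda>x1 x2. ?G (X * x1) (Y * x2) (Z * y)))) =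
      S a * intertwiner \<gamma>"
    unfolding intertwiner_def by (simp only: r1 r2 ev_mult_left)
  then show ?thesis
    using l quasi_coassociative_ev[OF G, of a] by simp
qed

lemma intertwiner_\<alpha>: "intertwiner \<gamma> * Si \<alpha> = \<gamma>"
proof -
  txt \<open>
    \<open>g\<close> annihilates, up to counits, a coproduct acting from the left on the first or the last pair
    of slots, and from the right on the middle pair. So it reduces the pentagon equation, multiplied
    from the right by \<open>\<Phi>inv \<otimes> 1\<close>, to its values at \<open>\<Phi>inv \<otimes> 1\<close> and at \<open>1 \<otimes> \<Phi>\<close>.
  \<close>
  define g where "g a b c d = S d * \<gamma> * c * Si \<beta> * Si b * Si \<alpha> * a" for a b c d
  have "quadlin g"
    unfolding g_def by (intro lin_hopf_intros)
  note g = quadlinD[OF this]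
  have K12: "ev2 (\<Delta> x) (\<lambda>x1 x2. g (x1 * a) (x2 * b) c d) = \<epsilon> x *s g a b c d" for x a b c d
  proof -
    have "ev2 (\<Delta> x) (\<lambda>x1 x2. g (x1 * a) (x2 * b) c d) =
        ev2 (\<Delta> x) (\<lambda>x1 x2. (S d * \<gamma> * c * Si \<beta> * Si b) * (Si x2 * Si \<alpha> * x1) * a)"
      by (simp add: g_def Si_mult mult.assoc)
    also have "\<dots> = \<epsilon> x *s g a b c d"
      by (simp only: ev_mult_left ev_mult_right antipode_cop_\<alpha> scale_mult_left scale_mult_right)
        (simp add: g_def mult.assoc)
    finally show ?thesis .
  qed
  have K23: "ev2 (\<Delta> x) (\<lambda>x1 x2. g a (b * x1) (c * x2) d) = \<epsilon> x *s g a b c d" for x a b c d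
  proof -
    have "ev2 (\<Delta> x) (\<lambda>x1 x2. g a (b * x1) (c * x2) d) =
        ev2 (\<Delta> x) (\<lambda>x1 x2. (S d * \<gamma> * c) * (x2 * Si \<beta> * Si x1) * (Si b * Si \<alpha> * a))"
      by (simp add: g_def Si_mult mult.assoc)
    also have "\<dots> = \<epsilon> x *s g a b c d"
      by (simp only: ev_mult_left ev_mult_right antipode_cop_\<beta> scale_mult_left scale_mult_right)
        (simp add: g_def mult.assoc)
    finally show ?thesis .
  qed
  have K34: "ev2 (\<Delta> x) (\<lambda>x1 x2. g a b (x1 * c) (x2 * d)) = \<epsilon> x *s g a b c d" for x a b c d
  proof -
    have "ev2 (\<Delta> x) (\<lambda>x1 x2. g a b (x1 * c) (x2 * d)) =
        ev2 (\<Delta> x) (\<lambda>x1 x2. S d * (S x2 * \<gamma> * x1) * (c * Si \<beta> * Si b * Si \<alpha> * a))"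
      by (simp add: g_def S_mult mult.assoc)
    also have "\<dots> = \<epsilon> x *s g a b c d"
      by (simp only: ev_mult_left ev_mult_right cop_antipode scale_mult_left scale_mult_right)
        (simp add: g_def mult.assoc)
    finally show ?thesis .
  qed
  define G where "G a b c d = ev3 \<Phi>inv (\<lambda>p q r. g (a * p) (b * q) (c * r) d)" for a b c d
  have "quadlin G"
    unfolding G_def by (intro lin_hopf_intros g)
  note lin_G = quadlinD[OF this]
  note pent = pentagon_ev[OF \<open>quadlin G\<close>]
  have G12: "ev2 (\<Delta> x) (\<lambda>x1 x2. G x1 x2 c d) = \<epsilon> x *s G 1 1 c d" for x c d
    unfolding G_def by (subst ev_swap) (simp add: K12 ev_scale)
  have G34: "ev2 (\<Delta> x) (\<lambda>x1 x2. G a b (x1 * c) (x2 * d)) = \<epsilon> x *s G a b c d" for x a b c d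
    unfolding G_def by (subst ev_swap) (simp add: K34 ev_scale mult.assoc)
  have 1: "ev2 (\<Delta> Z) (\<lambda>Z1 Z2. ev3 \<Phi> (\<lambda>X' Y' Z'. ev2 (\<Delta> X') (\<lambda>X1 X2.
        G (X * X1) (Y * X2) (Z1 * Y') (Z2 * Z')))) =
      \<epsilon> Z *s ev3 \<Phi> (\<lambda>X' Y' Z'. ev2 (\<Delta> X') (\<lambda>X1 X2. G (X * X1) (Y * X2) Y' Z'))" for X Y Z
    by (subst ev_swap, subst (2) ev_swap) (simp only: G34 ev_scale)
  have 2: "bilin (\<lambda>X Y. ev3 \<Phi> (\<lambda>X' Y' Z'. ev2 (\<Delta> X') (\<lambda>X1 X2. G (X * X1) (Y * X2) Y' Z')))"
    by (intro lin_hopf_intros lin_G)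
  have 3: "bilin (G 1 1)"
    by (intro lin_hopf_intros lin_G)
  \<comment> \<open>The value of \<open>g\<close> at \<open>\<Phi>inv \<otimes> 1\<close> is
    \<gamma> times the image under \<open>Si\<close> of the antipode identity for
    \<open>\<Phi>inv\<close>.\<close>
  have G1: "G 1 1 1 1 = \<gamma>"
  proof -
    have "G 1 1 1 1 = \<gamma> * Si (ev3 \<Phi>inv (\<lambda>x y z. S x * \<alpha> * y * \<beta> * S z))"
      unfolding G_def g_def
      by (simp add: ev_lin[OF lin_Si, symmetric] ev_mult_left[symmetric] Si_mult S_one mult.assoc)
    then show ?thesis
      by (simp add: antipode_\<Phi>inv_ev Si_one)
  qed
  \<comment> \<open>The order matters: \<open>counit_\<Phi>_right\<close> first sets the left
    factors \<open>X\<close> and \<open>Y\<close> to 1, so that the coproduct of \<open>X'\<close>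
    stands leftmost in its slots, where \<open>G12\<close> applies.\<close>
  have lhs: "ev3 \<Phi> (\<lambda>X Y Z. ev2 (\<Delta> Z) (\<lambda>Z1 Z2. ev3 \<Phi> (\<lambda>X' Y' Z'. ev2 (\<Delta> X') (\<lambda>X1 X2.
      G (X * X1) (Y * X2) (Z1 * Y') (Z2 * Z'))))) = \<gamma>"
    by (simp only: 1 counit_\<Phi>_right[OF 2] mult_1_left G12 counit_\<Phi>_left[OF 3] G1)
  \<comment> \<open>The factor \<open>\<Phi> \<otimes> 1\<close> of the pentagon cancels the
    \<open>\<Phi>inv \<otimes> 1\<close> built into \<open>G\<close>.\<close>
  have 4: "ev3 \<Phi> (\<lambda>P Q T. G (X * P) (b * Q) (c * T) d) = g X b c d" for X b c d
  proof -
    have "trilin (\<lambda>x y z. g (X * x) (b * y) (c * z) d)"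
      by (intro lin_hopf_intros g)
    from \<Phi>_\<Phi>inv_ev[OF this] show ?thesis
      by (simp add: G_def mult.assoc)
  qed
  have 5: "bilin (\<lambda>X Z. g X A B (C * Z))" for A B C
    by (intro lin_hopf_intros g)
  have "ev3 \<Phi> (\<lambda>A B C. ev3 \<Phi> (\<lambda>X Y Z. ev2 (\<Delta> Y) (\<lambda>Y1 Y2. ev3 \<Phi> (\<lambda>P Q T.
      G (X * P) (A * Y1 * Q) (B * Y2 * T) (C * Z))))) = ev3 \<Phi> (g 1)"
    by (simp only: 4 K23 counit_\<Phi>_middle[OF 5] mult_1_right)
  also have "\<dots> = intertwiner \<gamma> * Si \<alpha>"
    unfolding intertwiner_def g_def by (simp add: ev_mult_right)
  finally show ?thesis
    using lhs pent by simp
qed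

end

end

section \<open>The R-matrix and the products of \<open>check_u\<close> with
  \<open>S hat_u\<close>\<close>

context quasitriangular_quasi_hopf_algebra
begin

lemma R_closed: "R \<in> tensor_power 2"
  and Rinv_closed: "Rinv \<in> tensor_power 2"
  and R_Rinv: "tmult 2 R Rinv = tone 2"
  and Rinv_R: "tmult 2 Rinv R = tone 2"
  using tinverse[OF R_invertible] by (simp_all add: Rinv_def)

lemma R_Rinv_ev:
  assumes "bilin f"
  shows "ev2 R (\<lambda>s t. ev2 Rinv (\<lambda>s' t'. f (s * s') (t * t'))) = f 1 1"
  using ev2_tmult[OF R_closed Rinv_closed assms] by (simp add: R_Rinv ev2_tone assms)

lemma
  shows \<Delta>cop_closed: "\<Delta>cop a \<in> tensor_power 2"
    and ev_\<Delta>cop: "bilin f \<Longrightarrow> ev2 (\<Delta>cop a) f = ev2 (\<Delta> a) (\<lambda>x y. f y x)"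
proof -
  have "tmultilinear 2 2 (\<lambda>xs. pure [xs ! 1, xs ! 0])"
    by (rule tmultilinear_2) (rule tlin_pure_rules)+
  note * = sum_ten_closed_ev[OF \<Delta>_closed this]
  show "\<Delta>cop a \<in> tensor_power 2"
    unfolding \<Delta>cop_def by (rule *)
  show "ev2 (\<Delta>cop a) f = ev2 (\<Delta> a) (\<lambda>x y. f y x)" if "bilin f"
    unfolding \<Delta>cop_def using *(2)[OF multilinear_2[OF that]] by (simp only: ev2_pure[OF that])
qed

lemma R_cop_ev:
  assumes "bilin f"
  shows "ev2 (\<Delta> a) (\<lambda>x y. ev2 R (\<lambda>s t. f (y * s) (x * t))) =
    ev2 R (\<lambda>s t. ev2 (\<Delta> a) (\<lambda>x y. f (s * x) (t * y)))"
proof -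
  note f = bilinD[OF assms]
  have "bilin (\<lambda>x y. ev2 R (\<lambda>s t. f (x * s) (y * t)))"
    by (intro lin_hopf_intros f)
  note cop = ev_\<Delta>cop[OF this]
  show ?thesis
    using arg_cong[OF R_cop[of a], of "\<lambda>t. ev2 t f"]
    by (simp add: ev2_tmult[OF _ _ assms] \<Delta>cop_closed R_closed \<Delta>_closed cop)
qed

lemma Rinv_cop: "tmult 2 Rinv (\<Delta>cop a) = tmult 2 (\<Delta> a) Rinv"
proof -
  have "tmult 2 (tmult 2 Rinv (tmult 2 (\<Delta>cop a) R)) Rinv =
      tmult 2 (tmult 2 Rinv (tmult 2 R (\<Delta> a))) Rinv"
    by (simp only: R_cop)
  moreover have "tmult 2 (tmult 2 Rinv (tmult 2 (\<Delta>cop a) R)) Rinv = tmult 2 Rinv (\<Delta>cop a)"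
    by (simp add: tmult_assoc tmult_closed \<Delta>cop_closed R_closed Rinv_closed R_Rinv tmult_tone)
  moreover have "tmult 2 (tmult 2 Rinv (tmult 2 R (\<Delta> a))) Rinv = tmult 2 (\<Delta> a) Rinv"
    by (simp add: tmult_assoc[symmetric] tmult_closed \<Delta>_closed R_closed Rinv_closed Rinv_R
        tmult_tone)
  ultimately show ?thesis
    by simp
qed

lemma Rinv_cop_ev:
  assumes "bilin f"
  shows "ev2 Rinv (\<lambda>s t. ev2 (\<Delta> a) (\<lambda>x y. f (s * y) (t * x))) =
    ev2 (\<Delta> a) (\<lambda>x y. ev2 Rinv (\<lambda>s t. f (x * s) (y * t)))"
proof -
  note f = bilinD[OF assms]
  have "bilin (\<lambda>x y. f (s * x) (t * y))" for s t
    by (intro lin_hopf_intros f)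
  note cop = ev_\<Delta>cop[OF this]
  show ?thesis
    using arg_cong[OF Rinv_cop[of a], of "\<lambda>t. ev2 t f"]
    by (simp add: ev2_tmult[OF _ _ assms] \<Delta>cop_closed Rinv_closed \<Delta>_closed cop)
qed

lemma check_\<alpha>_ev: "check_\<alpha> = ev2 R (\<lambda>s t. S t * \<alpha> * s)"
  unfolding check_\<alpha>_def
  by (rule sum_alg_eq_ev[OF R_closed multilinear_2]) (intro lin_hopf_intros)

lemma hat_\<alpha>_ev: "hat_\<alpha> = ev2 Rinv (\<lambda>s t. S s * \<alpha> * t)"
  unfolding hat_\<alpha>_def
  by (rule sum_alg_eq_ev[OF Rinv_closed multilinear_2]) (intro lin_hopf_intros)

lemma check_u_eq: "check_u = intertwiner check_\<alpha>"
  unfolding check_u_def intertwiner_def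
  by (rule sum_alg_eq_ev[OF \<Phi>_closed multilinear_3]) (intro lin_hopf_intros)

lemma hat_u_eq: "hat_u = intertwiner hat_\<alpha>"
  unfolding hat_u_def intertwiner_def
  by (rule sum_alg_eq_ev[OF \<Phi>_closed multilinear_3]) (intro lin_hopf_intros)

text \<open>Replacing \<open>R \<Delta>(a)\<close> by \<open>\<Delta>cop(a) R\<close> brings the two
  legs of the coproduct next to \<alpha>, in the order of the antipode axiom.\<close>

lemma check_\<alpha>_cop_antipode: "ev2 (\<Delta> a) (\<lambda>x y. S y * check_\<alpha> * x) = \<epsilon> a *s check_\<alpha>"
proof -
  have f: "bilin (\<lambda>p q. S q * \<alpha> * p)"
    by (intro lin_hopf_intros)
  have "ev2 (\<Delta> a) (\<lambda>x y. S y * check_\<alpha> * x) =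
      ev2 R (\<lambda>s t. ev2 (\<Delta> a) (\<lambda>x y. S (t * y) * \<alpha> * (s * x)))"
    unfolding check_\<alpha>_ev ev_mult_left[symmetric] ev_mult_right[symmetric]
    by (subst ev_swap) (simp add: S_mult mult.assoc)
  also have "\<dots> = ev2 R (\<lambda>s t. ev2 (\<Delta> a) (\<lambda>x y. S t * (S x * \<alpha> * y) * s))"
    unfolding R_cop_ev[OF f, symmetric] by (subst ev_swap) (simp add: S_mult mult.assoc)
  also have "\<dots> = \<epsilon> a *s check_\<alpha>"
    by (simp only: ev_mult_left ev_mult_right antipode_\<alpha>_ev scale_mult_left scale_mult_right
        ev_scale check_\<alpha>_ev)
  finally show ?thesis .
qed

text \<open>Here \<open>Rinv \<Delta>cop(a)\<close> becomes \<open>\<Delta>(a) Rinv\<close>; the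
  legs of \<open>Rinv\<close> surround \<alpha> in the opposite order, which compensates for the
  exchange.\<close>

lemma hat_\<alpha>_cop_antipode: "ev2 (\<Delta> a) (\<lambda>x y. S y * hat_\<alpha> * x) = \<epsilon> a *s hat_\<alpha>"
proof -
  have f: "bilin (\<lambda>p q. S p * \<alpha> * q)"
    by (intro lin_hopf_intros)
  have "ev2 (\<Delta> a) (\<lambda>x y. S y * hat_\<alpha> * x) =
      ev2 Rinv (\<lambda>s t. ev2 (\<Delta> a) (\<lambda>x y. S (s * y) * \<alpha> * (t * x)))"
    unfolding hat_\<alpha>_ev ev_mult_left[symmetric] ev_mult_right[symmetric]
    by (subst ev_swap) (simp add: S_mult mult.assoc)
  also have "\<dots> = ev2 Rinv (\<lambda>s t. ev2 (\<Delta> a) (\<lambda>x y. S s * (S x * \<alpha> * y) * t))"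
    unfolding Rinv_cop_ev[OF f] by (subst ev_swap) (simp add: S_mult mult.assoc)
  also have "\<dots> = \<epsilon> a *s hat_\<alpha>"
    by (simp only: ev_mult_left ev_mult_right antipode_\<alpha>_ev scale_mult_left scale_mult_right
        ev_scale hat_\<alpha>_ev)
  finally show ?thesis .
qed

lemmas check_u_rules =
  S_intertwiner[OF check_\<alpha>_cop_antipode, folded check_u_eq]
  intertwiner_\<alpha>[OF check_\<alpha>_cop_antipode, folded check_u_eq]

lemmas hat_u_rules =
  S_intertwiner[OF hat_\<alpha>_cop_antipode, folded hat_u_eq]

text \<open>S reverses products, so the two nested sums around \<alpha> combine to the product of
  \<open>R\<close> and \<open>Rinv\<close>, in this order.\<close>

lemma \<alpha>_from_check_\<alpha>: "ev2 Rinv (\<lambda>s t. S t * check_\<alpha> * s) = \<alpha>"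
proof -
  have f: "bilin (\<lambda>p q. S q * \<alpha> * p)"
    by (intro lin_hopf_intros)
  have "ev2 Rinv (\<lambda>s t. S t * check_\<alpha> * s) =
      ev2 R (\<lambda>s t. ev2 Rinv (\<lambda>s' t'. S (t * t') * \<alpha> * (s * s')))"
    unfolding check_\<alpha>_ev ev_mult_left[symmetric] ev_mult_right[symmetric]
    by (subst ev_swap) (simp add: S_mult mult.assoc)
  then show ?thesis
    by (simp add: R_Rinv_ev[OF f] S_one)
qed

text \<open>\<open>check_u\<close> moves left past \<open>S (S s)\<close>, leaving \<open>s\<close>
  behind, and then past \<open>S \<alpha>\<close>, where \<open>check_u * Si \<alpha>\<close> is
  \<open>check_\<alpha>\<close>. What remains is the sum that undoes \<open>R\<close>.\<close>

lemma S_hat_\<alpha>_check_u: "S hat_\<alpha> * check_u = \<alpha>"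
proof -
  have *: "S \<alpha> * (S (S s) * check_u) = check_\<alpha> * s" for s
    by (simp add: check_u_rules(1) mult.assoc[symmetric]) (simp add: check_u_rules)
  have "S hat_\<alpha> * check_u = ev2 Rinv (\<lambda>s t. S t * (S \<alpha> * (S (S s) * check_u)))"
    unfolding hat_\<alpha>_ev
    by (simp only: ev_lin[OF S_linear, symmetric] ev_mult_right[symmetric] S_mult mult.assoc)
  also have "\<dots> = \<alpha>"
    using \<alpha>_from_check_\<alpha> by (simp only: * mult.assoc)
  finally show ?thesis .
qed

text \<open>\<open>check_u\<close> moves left past \<open>S (S Z)\<close> until it meets
  \<open>S hat_\<alpha>\<close> and becomes \<alpha>; the antipode identity for \<Phi> is
  left.\<close>

lemma S_hat_u_check_u: "S hat_u * check_u = 1"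
proof -
  have "S hat_u * check_u =
      ev3 \<Phi> (\<lambda>X Y Z. X * \<beta> * S Y * (S hat_\<alpha> * (S (S Z) * check_u)))"
    unfolding hat_u_eq intertwiner_def
    by (simp only: ev_lin[OF S_linear, symmetric] ev_mult_right[symmetric] S_mult mult.assoc S_Si)
  also have "\<dots> = ev3 \<Phi> (\<lambda>X Y Z. X * \<beta> * S Y * \<alpha> * Z)"
    by (simp add: check_u_rules(1)) (simp only: mult.assoc[symmetric], simp add: mult.assoc[of _ "S hat_\<alpha>"] S_hat_\<alpha>_check_u)
  finally show ?thesis
    by (simp only: antipode_\<Phi>_ev)
qed

text \<open>A one-sided inverse in a noncommutative ring need not be two-sided. Centrality allows
  the idempotent \<open>e\<close> to be moved next to any \<alpha> inside a sum.\<close>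

lemma check_u_S_hat_u: "check_u * S hat_u = 1"
proof -
  define e where "e = check_u * S hat_u"
  have "S (S a) * e = e * S (S a)" for a
  proof -
    have "S (S a) * e = check_u * a * S hat_u"
      unfolding e_def by (simp add: mult.assoc[symmetric] check_u_rules(1))
    also have "a * S hat_u = S hat_u * S (S a)"
      using arg_cong[OF hat_u_rules[of a], of S] by (simp add: S_mult)
    then have "check_u * a * S hat_u = e * S (S a)"
      unfolding e_def by (simp add: mult.assoc)
    finally show ?thesis .
  qed
  \<comment> \<open>Every element has the form \<open>S (S a)\<close>, as S is surjective.\<close>
  then have central: "a * e = e * a" for a
    by (metis S_Si)
  \<comment> \<open>\<open>e\<close> fixes \<open>check_u\<close> by the product already known, and
    \<open>check_\<alpha>\<close> is a right multiple of \<open>check_u\<close>.\<close>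
  have "e * check_\<alpha> = check_\<alpha>"
    using check_u_rules(2) S_hat_u_check_u unfolding e_def by (metis mult.assoc mult_1_left)
  then have *: "S t * check_\<alpha> * s = e * (S t * check_\<alpha> * s)" for s t
    by (metis central mult.assoc)
  have "e * \<alpha> = ev2 Rinv (\<lambda>s t. e * (S t * check_\<alpha> * s))"
    by (simp only: ev_mult_left \<alpha>_from_check_\<alpha>)
  also have "\<dots> = \<alpha>"
    by (simp only: *[symmetric] \<alpha>_from_check_\<alpha>)
  finally have "e * (x * \<beta> * S y * \<alpha> * z) = x * \<beta> * S y * \<alpha> * z" for x y z
    by (metis central mult.assoc)
  then have "e * ev3 \<Phi> (\<lambda>x y z. x * \<beta> * S y * \<alpha> * z) = ev3 \<Phi> (\<lambda>x y z. x * \<beta> * S y * \<alpha> * z)"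
    by (simp only: ev_mult_left[symmetric])
  then show ?thesis
    by (simp add: antipode_\<Phi>_ev e_def)
qed

text \<open>Writing \<open>check_\<alpha>\<close> as \<open>check_u * Si \<alpha>\<close> lets
  \<open>check_u\<close> move to the front, and the remaining factors are the antipode identity for
  \<open>\<Phi>inv\<close> under \<open>Si\<close>.\<close>

lemma drinfeld_element_eq: "drinfeld_element = check_u"
proof -
  have inner: "sum_alg2 R (\<lambda>s t. S (y * \<beta> * S z) * S t * \<alpha> * s * x) =
      S (y * \<beta> * S z) * check_\<alpha> * x" for x y z
  proof -
    have "sum_alg2 R (\<lambda>s t. S (y * \<beta> * S z) * S t * \<alpha> * s * x) =
        ev2 R (\<lambda>s t. S (y * \<beta> * S z) * S t * \<alpha> * s * x)"
      by (rule sum_alg_eq_ev[OF R_closed multilinear_2]) (intro lin_hopf_intros)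
    then show ?thesis
      by (simp only: check_\<alpha>_ev ev_mult_left[symmetric] ev_mult_right[symmetric] mult.assoc)
  qed
  have "drinfeld_element = ev3 \<Phi>inv (\<lambda>x y z. S (y * \<beta> * S z) * check_\<alpha> * x)"
    unfolding drinfeld_element_def inner
    by (rule sum_alg_eq_ev[OF \<Phi>inv_closed multilinear_3]) (intro lin_hopf_intros)
  also have "\<dots> = ev3 \<Phi>inv (\<lambda>x y z. check_u * Si (S x * \<alpha> * y * \<beta> * S z))"
  proof -
    have "S c * check_\<alpha> * x = check_u * Si (S x * \<alpha> * c)" for c x
      unfolding check_u_rules(2)[symmetric]
      by (simp add: mult.assoc[symmetric] check_u_rules(1) Si_mult)
    then show ?thesis
      by (simp add: mult.assoc)
  qed
  also have "\<dots> = check_u"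
    by (simp only: ev_mult_left ev_lin[OF lin_Si] antipode_\<Phi>inv_ev Si_one mult_1_right)
  finally show ?thesis .
qed

end

section \<open>Two-sided inverses and the final identities\<close>

lemma inverse_elem_eqI:
  assumes "a * b = 1" "b * a = 1"
  shows "inverse_elem a = b"
  unfolding inverse_elem_def
proof (rule the_equality)
  fix c assume "a * c = 1 \<and> c * a = 1"
  then show "c = b"
    using assms by (metis mult.assoc mult_1_left mult_1_right)
qed (use assms in simp)

theorem proposition2p1:
  fixes scale :: "'k::field \<Rightarrow> 'a::ring_1 \<Rightarrow> 'a"
    and \<Delta> :: "'a \<Rightarrow> ('k, 'a) tensor"
    and \<epsilon> :: "'a \<Rightarrow> 'k"
    and \<Phi> :: "('k, 'a) tensor"
    and S :: "'a \<Rightarrow> 'a"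
    and \<alpha> \<beta> :: 'a
    and R :: "('k, 'a) tensor"
  assumes "quasitriangular_quasi_hopf_algebra scale \<Delta> \<epsilon> \<Phi> S \<alpha> \<beta> R"
  shows "invertible_elem (quasitriangular_quasi_hopf_algebra.hat_u scale \<Phi> S \<alpha> \<beta> R)
    \<and> invertible_elem (quasitriangular_quasi_hopf_algebra.check_u scale \<Phi> S \<alpha> \<beta> R)
    \<and> quasitriangular_quasi_hopf_algebra.drinfeld_element scale \<Phi> S \<alpha> \<beta> R
         = quasitriangular_quasi_hopf_algebra.check_u scale \<Phi> S \<alpha> \<beta> R
    \<and> quasitriangular_quasi_hopf_algebra.check_u scale \<Phi> S \<alpha> \<beta> R
         = S (inverse_elem (quasitriangular_quasi_hopf_algebra.hat_u scale \<Phi> S \<alpha> \<beta> R))"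
proof -
  interpret quasitriangular_quasi_hopf_algebra scale \<Delta> \<epsilon> \<Phi> S \<alpha> \<beta> R
    by fact
  \<comment> \<open>\<open>Si\<close> reverses products, so each of the two relations between
    \<open>check_u\<close> and \<open>S hat_u\<close> yields one for \<open>hat_u\<close> and
    \<open>Si check_u\<close>.\<close>
  have inv: "hat_u * Si check_u = 1" "Si check_u * hat_u = 1"
    using arg_cong[OF check_u_S_hat_u, of Si] arg_cong[OF S_hat_u_check_u, of Si]
    by (simp_all add: Si_mult Si_one)
  show ?thesis
    unfolding invertible_elem_def inverse_elem_eqI[OF inv] drinfeld_element_eq S_Si
    using inv S_hat_u_check_u check_u_S_hat_u by blast
qed

end
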